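(* Let $\{f(n): n\in\mathbb{Z}\}$ be independent and identically distributed random variables with law $\mu$ supported in $[0,\infty)$. If $\mu$ has finite mean, then for almost every realization of $f$ the following holds: three independent simple random walks $X,X',X''$ on $\mathrm{Comb}(\mathbb{Z},f)$, started from the same vertex, collide together infinitely many times with probability one, i.e. $|\{n: X_n=X'_n=X''_n\}|=\infty$ almost surely.
   Context: For $f:\mathbb{Z}\to[0,\infty)$, the wedge comb $\mathrm{Comb}(\mathbb{Z},f)$ is the graph with vertex set $\mathbb{V}=\{(x,y): x,y\in\mathbb{Z},\ -f(x)\le y\le f(x)\}$ and edge set $\{[(x,n),(x,m)]: |m-n|=1\}\cup\{[(x,0),(y,0)]: |x-y|=1\}$ (edges between vertices of $\mathbb{V}$). The simple random walk on a graph is the discrete-time Markov chain that at each step jumps from the current vertex to a uniformly chosen neighbour. Given the realization of $f$, the three walks are run independently on the fixed graph $\mathrm{Comb}(\mathbb{Z},f)$. *)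

theory Defs
  imports "HOL-Probability.Probability"
begin

definition comb_vertices :: "(int \<Rightarrow> real) \<Rightarrow> (int \<times> int) set" where
  "comb_vertices f = {(x, y). - f x \<le> real_of_int y \<and> real_of_int y \<le> f x}"

text \<open>Undirected edges are two-element sets of vertices.\<close>

definition comb_edges :: "(int \<Rightarrow> real) \<Rightarrow> (int \<times> int) set set" where
  "comb_edges f =
     {{(x, n), (x, m)} | x n m.
        (x, n) \<in> comb_vertices f \<and> (x, m) \<in> comb_vertices f \<and> \<bar>m - n\<bar> = 1} \<union>
     {{(x, 0), (y, 0)} | x y.
        (x, 0) \<in> comb_vertices f \<and> (y, 0) \<in> comb_vertices f \<and> \<bar>x - y\<bar> = 1}"

definition neighbours :: "'v set set \<Rightarrow> 'v \<Rightarrow> 'v set" where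
  "neighbours E v = {u. {v, u} \<in> E}"

text \<open>
  The law of \<^term>\<open>pmf_of_set A\<close> is meaningful only for finite nonempty \<^term>\<open>A\<close>. In a comb
  with nonnegative profile every vertex has between one and four neighbours, so the definition
  below is only applied to graphs for which this is the case.
\<close>

definition simple_random_walk ::
    "'v set set \<Rightarrow> 'v \<Rightarrow> 'b measure \<Rightarrow> (nat \<Rightarrow> 'b \<Rightarrow> 'v) \<Rightarrow> bool" where
  "simple_random_walk E v N X \<longleftrightarrow>
     prob_space N \<and>
     (\<forall>n. X n \<in> measurable N (count_space UNIV)) \<and>
     (AE \<omega> in N. X 0 \<omega> = v) \<and>
     (\<forall>n h u. \<P>(\<omega> in N. \<forall>k\<le>n. X k \<omega> = h k) > 0 \<longrightarrow>
        \<P>(\<omega> in N. X (Suc n) \<omega> = u \<bar> \<forall>k\<le>n. X k \<omega> = h k)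
          = pmf (pmf_of_set (neighbours E (h n))) u)"

text \<open>
  Independence of whole trajectories: each walk is one random variable with values in the path
  space, equipped with the product sigma-algebra.
\<close>

definition indep_walks :: "'b measure \<Rightarrow> (nat \<Rightarrow> nat \<Rightarrow> 'b \<Rightarrow> 'v) \<Rightarrow> nat set \<Rightarrow> bool" where
  "indep_walks N X I \<longleftrightarrow>
     prob_space.indep_vars N (\<lambda>_. PiM UNIV (\<lambda>_::nat. count_space UNIV))
       (\<lambda>i \<omega> n. X i n \<omega>) I"

end

theory Submission
  imports Defs
begin

text \<open>
  On the full line three independent walks meet at time \<open>n\<close> with probability of order \<open>1/n\<close>, so the
  expected number of triple collisions diverges, but only logarithmically. The proof shows that the
  comb keeps this borderline behaviour, that the logarithm is large enough for a second moment
  argument, and that infinitely many collisions have probability zero or one. Write \<open>p\<^sub>n(v,u)\<close> for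
  the \<open>n\<close>-step transition probability of one walk (\<open>hk\<close> below).

  \<^bold>\<open>Upper bound, valid on every comb\<close> (\<open>heat_kernel_bound\<close>): \<open>p\<^sub>n(v,u) \<le> C / \<surd>n\<close>. For each vertex
  \<open>v\<close> there is an explicit potential that vanishes at \<open>v\<close>, is 1-Lipschitz and is harmonic except
  at \<open>v\<close>: it grows linearly along the unique way from \<open>v\<close> down its tooth and then along the spine.
  Its value along the walk has mean comparable to the expected number of returns to \<open>v\<close>, and mean
  square at most \<open>n\<close>; hence at most of order \<open>\<surd>n\<close> returns are expected up to time \<open>n\<close>. By reversibility
  the even return probabilities are convex, hence decreasing, in time, and this turns the
  bound for the sum into a pointwise one. Consequently the conditional probability of a
  collision \<open>n\<close> steps after a collision is at most of order \<open>1/n\<close>.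

  \<^bold>\<open>Lower bound, for typical profiles\<close>: the horizontal displacement has mean square at most \<open>2n\<close>,
  so with probability at least \<open>3/4\<close> the walk is at time \<open>n\<close> in the columns at distance \<open>O(\<surd>n)\<close> from the start.
  If these columns contain \<open>S\<^sub>n\<close> vertices, convexity gives \<open>\<Sum>\<^sub>u p\<^sub>n(v,u)^3 \<ge> c / S\<^sub>n^2\<close>. The mean of
  \<open>S\<^sub>n\<close> is \<open>O(\<surd>n)\<close> because the teeth have finite mean, and Fatou's lemma, applied to the
  logarithmic averages of \<open>S\<^sub>n / \<surd>n\<close>, shows that for almost every profile these averages are bounded
  along a subsequence (\<open>typical_environment\<close>). So the expected number of collisions up to time \<open>n\<close>
  exceeds a multiple of \<open>log n\<close> for infinitely many \<open>n\<close> (\<open>collision_sum_lower\<close>).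

  The two bounds together make the second moment of the number of collisions comparable to
  the square of its mean along this subsequence, so infinitely many collisions have
  positive probability (\<open>inf_visits_pos\<close>).

  \<^bold>\<open>Zero-one law\<close>: the probability of infinitely many collisions, as a function of the three
  positions, is bounded and harmonic for the joint walk. A Choquet--Deny argument shows that it is
  invariant under two steps of each coordinate separately
  (\<open>two_step_invariant_coordinates\<close>). Bounded harmonic functions on a comb are constant, being
  constant on teeth and affine along the spine; so the function depends only on the parities of the
  three positions, and these agree at all times for walks with a common start. A conditional
  probability that does not depend on the past is zero or one (\<open>zero_one_law\<close>).
\<close>

section \<open>Averaging operators and the Choquet--Deny argument\<close>

text \<open>
  All kernels below have finite support. As a finite sum the one-step expectation can be
  rearranged and interchanged with limits for arbitrary functions, without integrability conditions.
\<close>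

definition avg :: "('s \<Rightarrow> 's pmf) \<Rightarrow> ('s \<Rightarrow> real) \<Rightarrow> 's \<Rightarrow> real" where
  "avg Q g s = (\<Sum>t\<in>set_pmf (Q s). pmf (Q s) t * g t)"

definition markov_op :: "(('s \<Rightarrow> real) \<Rightarrow> 's \<Rightarrow> real) \<Rightarrow> bool" where
  "markov_op A \<longleftrightarrow>
     (\<forall>a b f g. A (\<lambda>s. a * f s + b * g s) = (\<lambda>s. a * A f s + b * A g s)) \<and>
     (\<forall>f. (\<forall>s. 0 \<le> f s) \<longrightarrow> (\<forall>s. 0 \<le> A f s)) \<and>
     A (\<lambda>_. 1) = (\<lambda>_. 1)"

lemma markov_op_lin:
  "markov_op A \<Longrightarrow> A (\<lambda>s. a * f s + b * g s) = (\<lambda>s. a * A f s + b * A g s)"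
  by (simp add: markov_op_def)

lemma markov_op_nonneg: "markov_op A \<Longrightarrow> (\<And>s. 0 \<le> f s) \<Longrightarrow> 0 \<le> A f s"
  by (simp add: markov_op_def)

lemma markov_op_const: assumes "markov_op A" shows "A (\<lambda>_. c) = (\<lambda>_. c)"
  using markov_op_lin[OF assms, of c "\<lambda>_. 1" 0 "\<lambda>_. 1"] assms
  by (simp add: markov_op_def)

lemma markov_op_diff:
  "markov_op A \<Longrightarrow> A (\<lambda>s. f s - g s) = (\<lambda>s. A f s - A g s)"
  using markov_op_lin[of A 1 f "-1" g] by simp

lemma markov_op_add:
  "markov_op A \<Longrightarrow> A (\<lambda>s. f s + g s) = (\<lambda>s. A f s + A g s)"
  using markov_op_lin[of A 1 f "1" g] by simp

lemma markov_op_scale: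
  "markov_op A \<Longrightarrow> A (\<lambda>s. a * f s) = (\<lambda>s. a * A f s)"
  using markov_op_lin[of A a f 0 f] by simp

lemma markov_op_sum:
  assumes "markov_op A"
  shows "A (\<lambda>s. \<Sum>i\<in>I. f i s) = (\<lambda>s. \<Sum>i\<in>I. A (f i) s)"
proof (induction I rule: infinite_finite_induct)
  case (insert i I)
  then show ?case using markov_op_add[OF assms, of "f i" "\<lambda>s. \<Sum>i\<in>I. f i s"] by simp
qed (use markov_op_const[OF assms, of 0] in auto)

lemma markov_op_mono:
  assumes "markov_op A" "\<And>s. f s \<le> g s" shows "A f s \<le> A g s"
  using markov_op_nonneg[OF assms(1), of "\<lambda>s. g s - f s" s] markov_op_diff[OF assms(1), of g f]
    assms(2) by simp

lemma markov_op_compose: "markov_op A \<Longrightarrow> markov_op B \<Longrightarrow> markov_op (\<lambda>f. A (B f))"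
  unfolding markov_op_def by metis

lemma markov_op_funpow: assumes "markov_op A" shows "markov_op (A ^^ n)"
proof (induction n)
  case 0 then show ?case by (simp add: markov_op_def)
next
  case (Suc n) then show ?case using markov_op_compose[OF assms Suc] by (simp add: comp_def)
qed

text \<open>
  Suppose that \<open>d = A g - g\<close> has supremum \<open>M > 0\<close>. Since \<open>d\<close> is invariant under \<open>A U\<close> and \<open>A\<close>
  dominates a multiple of the identity, a point where \<open>d\<close> is close enough to \<open>M\<close> forces
  \<open>A\<^sup>j U\<^sup>n d\<close> to be at least \<open>M/2\<close> at the same point for every \<open>j < n\<close>. These \<open>n\<close> values add up
  to at least \<open>n M/2\<close>, but their sum telescopes to a difference of two values between 0 and 1.
\<close>

lemma choquet_deny:
  assumes A: "markov_op A" and U: "markov_op U"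
    and comm: "\<And>f. A (U f) = U (A f)"
    and "\<epsilon> > 0" and lazy: "\<And>f s. (\<And>t. 0 \<le> f t) \<Longrightarrow> \<epsilon> * f s \<le> A f s"
    and inv: "A (U g) = g" and bdd: "\<And>s. 0 \<le> g s" "\<And>s. g s \<le> 1"
  shows "A g s \<le> g s"
proof (rule ccontr)
  assume "\<not> A g s \<le> g s"
  define d where "d = (\<lambda>s. A g s - g s)"
  have An: "markov_op (A ^^ n)" and Un: "markov_op (U ^^ n)" for n
    using A U by (simp_all add: markov_op_funpow)
  have Ag1: "0 \<le> A f s" "A f s \<le> 1"
    if "\<And>s. 0 \<le> f s" "\<And>s. f s \<le> 1" "markov_op A" for f s and A :: "('a \<Rightarrow> real) \<Rightarrow> 'a \<Rightarrow> real"
    using that markov_op_nonneg[of A f] markov_op_mono[of A f "\<lambda>_. 1"] markov_op_const[of A 1]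
    by auto
  have bddd: "bdd_above (range d)"
  proof (rule bdd_aboveI2)
    show "d s \<le> 1" for s
    proof -
      have "A g s \<le> 1" by (rule Ag1(2)) (use bdd A in auto)
      with bdd(1)[of s] show ?thesis by (simp add: d_def)
    qed
  qed
  define M where "M = (SUP s. d s)"
  have dM: "d s \<le> M" for s unfolding M_def by (rule cSUP_upper[OF _ bddd]) simp
  have "M > 0" using dM[of s] \<open>\<not> A g s \<le> g s\<close> by (simp add: d_def)
  have AU: "A (U d) = d"
    unfolding d_def using inv comm[of g] comm[of "A g"]
    by (simp add: markov_op_diff[OF U] markov_op_diff[OF A])
  have commAn: "A ((U ^^ n) f) = (U ^^ n) (A f)" for n f
    by (induction n) (simp_all add: comm)
  obtain n where n: "real n * M > 2"
    using reals_Archimedean3[OF \<open>M > 0\<close>] by blast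
  have expand: "((A ^^ k) ((U ^^ k) (\<lambda>s. M - d s))) = (\<lambda>s. M - d s)" for k
  proof (induction k)
    case (Suc k)
    have c: "U (\<lambda>s. M - d s) = (\<lambda>s. M - U d s)"
      by (simp add: markov_op_diff[OF U] markov_op_const[OF U])
    have "A (U (\<lambda>s. M - d s)) = (\<lambda>s. M - d s)"
      unfolding c by (simp add: markov_op_diff[OF A] markov_op_const[OF A] AU)
    moreover have "(A ^^ Suc k) ((U ^^ Suc k) f) = (A ^^ k) ((U ^^ k) (A (U f)))" for f
      by (simp only: funpow_Suc_right comp_def commAn)
    ultimately show ?case using Suc by metis
  qed simp
  \<comment> \<open>the factor \<open>(min \<epsilon> 1)^n\<close> pays for up to \<open>n\<close> uses of laziness, whatever the size of \<open>\<epsilon>\<close>\<close>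
  define \<delta> where "\<delta> = M / 2 * (min \<epsilon> 1) ^ n"
  have "\<delta> > 0" using \<open>M > 0\<close> \<open>\<epsilon> > 0\<close> by (simp add: \<delta>_def)
  then obtain s where s: "d s > M - \<delta>"
    using less_cSUP_iff[OF _ bddd, of "M - \<delta>"] by (auto simp: M_def)
  have pw: "\<epsilon> ^ k * f s \<le> (A ^^ k) f s" if "\<And>t. 0 \<le> f t" for k f s
  proof (induction k arbitrary: s)
    case (Suc k)
    have "\<epsilon> * (\<epsilon> ^ k * f s) \<le> \<epsilon> * (A ^^ k) f s" using Suc \<open>\<epsilon> > 0\<close> by (simp add: mult_left_mono)
    also have "\<dots> \<le> A ((A ^^ k) f) s"
      by (rule lazy) (rule markov_op_nonneg[OF An that])
    finally show ?case by (simp add: mult.assoc)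
  qed simp
  have low: "(A ^^ j) ((U ^^ n) d) s \<ge> M / 2" if "j < n" for j
  proof -
    let ?f = "(A ^^ j) ((U ^^ n) (\<lambda>s. M - d s))"
    have nn: "0 \<le> ?f t" for t
      by (rule markov_op_nonneg[OF An] markov_op_nonneg[OF Un])+ (simp add: dM)
    have "(min \<epsilon> 1) ^ n \<le> (min \<epsilon> 1) ^ (n - j)"
      using \<open>\<epsilon> > 0\<close> by (intro power_decreasing) auto
    also have "\<dots> \<le> \<epsilon> ^ (n - j)" using \<open>\<epsilon> > 0\<close> by (intro power_mono) auto
    finally have "(min \<epsilon> 1) ^ n * ?f s \<le> \<epsilon> ^ (n - j) * ?f s"
      using nn by (simp add: mult_right_mono)
    also have "\<dots> \<le> (A ^^ (n - j)) ?f s" by (rule pw[OF nn])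
    also have "\<dots> = (A ^^ n) ((U ^^ n) (\<lambda>s. M - d s)) s"
      using that by (metis add_diff_cancel_left' comp_apply funpow_add le_add_diff_inverse2 less_imp_le)
    also have "\<dots> = M - d s" by (simp add: expand)
    also have "\<dots> < \<delta>" using s by simp
    finally have "(min \<epsilon> 1) ^ n * ?f s < (min \<epsilon> 1) ^ n * (M / 2)" by (simp add: \<delta>_def mult_ac)
    hence "?f s < M / 2" using \<open>\<epsilon> > 0\<close> by (simp add: mult_less_cancel_left)
    moreover have "?f s = M - (A ^^ j) ((U ^^ n) d) s"
      by (simp add: markov_op_diff[OF Un] markov_op_const[OF Un]
          markov_op_diff[OF An] markov_op_const[OF An])
    ultimately show ?thesis by simp
  qed
  have tel: "(\<Sum>j<m. (A ^^ j) ((U ^^ n) d) s) = (A ^^ m) ((U ^^ n) g) s - (U ^^ n) g s" for m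
  proof (induction m)
    case (Suc m)
    have "(A ^^ m) ((U ^^ n) d) s = (A ^^ Suc m) ((U ^^ n) g) s - (A ^^ m) ((U ^^ n) g) s"
      unfolding d_def by (simp only: markov_op_diff[OF Un] markov_op_diff[OF An] commAn
          funpow_Suc_right comp_def)
    then show ?case using Suc by simp
  qed simp
  have "real n * (M / 2) \<le> (\<Sum>j<n. (A ^^ j) ((U ^^ n) d) s)"
    using sum_mono[of "{..<n}" "\<lambda>_. M / 2" "\<lambda>j. (A ^^ j) ((U ^^ n) d) s"] low by simp
  also have "\<dots> \<le> 1"
    unfolding tel using Ag1[of g "U ^^ n"] Ag1[of "(U ^^ n) g" "A ^^ n" s] bdd Un An
    by (smt (verit, best))
  finally show False using n by simp
qed

text \<open>
  The reverse inequality is the previous lemma for \<open>1 - g\<close>. For \<open>U\<close>,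
  commutation and \<open>A g = g\<close> give \<open>U g = U A g = A U g = g\<close>.
\<close>

lemma choquet_deny_eq:
  assumes A: "markov_op A" and U: "markov_op U"
    and comm: "\<And>f. A (U f) = U (A f)"
    and "\<epsilon> > 0" and lazy: "\<And>f s. (\<And>t. 0 \<le> f t) \<Longrightarrow> \<epsilon> * f s \<le> A f s"
    and inv: "A (U g) = g" and bdd: "\<And>s. 0 \<le> g s" "\<And>s. g s \<le> 1"
  shows "A g = g" "U g = g"
proof -
  have 1: "A g s \<le> g s" for s by (rule choquet_deny[OF assms])
  have "A (\<lambda>s. 1 - g s) s \<le> 1 - g s" for s
    by (rule choquet_deny[OF A U comm \<open>\<epsilon> > 0\<close> lazy])
      (use inv bdd in \<open>simp_all add: markov_op_diff[OF A] markov_op_const[OF A]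
          markov_op_diff[OF U] markov_op_const[OF U]\<close>)
  hence 2: "g s \<le> A g s" for s
    by (simp add: markov_op_diff[OF A] markov_op_const[OF A])
  show "A g = g" using 1 2 by (auto intro!: ext antisym)
  then show "U g = g" using inv comm[of g] by simp
qed

lemma markov_op_avg:
  assumes "\<And>s. finite (set_pmf (Q s))" shows "markov_op (avg Q)"
  unfolding markov_op_def avg_def
  by (auto simp: sum.distrib sum_distrib_left algebra_simps sum_pmf_eq_1[OF assms]
      intro!: sum_nonneg)

lemma avg_cong: "(\<And>t. t \<in> set_pmf (Q s) \<Longrightarrow> f t = g t) \<Longrightarrow> avg Q f s = avg Q g s"
  unfolding avg_def by (intro sum.cong) auto

lemma avg_mono: "(\<And>t. t \<in> set_pmf (Q s) \<Longrightarrow> f t \<le> g t) \<Longrightarrow> avg Q f s \<le> avg Q g s"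
  unfolding avg_def by (intro sum_mono mult_left_mono) auto

definition pair_kernel ::
    "('s \<Rightarrow> 's pmf) \<Rightarrow> ('t \<Rightarrow> 't pmf) \<Rightarrow> 's \<times> 't \<Rightarrow> ('s \<times> 't) pmf" where
  "pair_kernel Q R = (\<lambda>(s, t). pair_pmf (Q s) (R t))"

lemma avg_pair_kernel:
  "avg (pair_kernel Q R) g (s, t) = avg Q (\<lambda>s'. avg R (\<lambda>t'. g (s', t')) t) s"
proof -
  have "avg (pair_kernel Q R) g (s, t) = (\<Sum>(s', t')\<in>set_pmf (Q s) \<times> set_pmf (R t).
      pmf (Q s) s' * (pmf (R t) t' * g (s', t')))"
    by (auto simp: avg_def pair_kernel_def pmf_pair mult.assoc intro!: sum.cong)
  then show ?thesis by (simp add: avg_def sum.cartesian_product[symmetric] sum_distrib_left)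
qed

lemma avg_swap:
  "avg Q (\<lambda>s'. avg R (\<lambda>t'. g s' t') t) s = avg R (\<lambda>t'. avg Q (\<lambda>s'. g s' t') s) t"
  unfolding avg_def sum_distrib_left by (subst sum.swap) (simp add: mult_ac)

lemma avg_funpow_swap:
  "avg Q (\<lambda>s'. (avg R ^^ n) (g s') t) s = (avg R ^^ n) (\<lambda>t'. avg Q (\<lambda>s'. g s' t') s) t"
proof (induction n arbitrary: t)
  case (Suc n)
  have "avg Q (\<lambda>s'. (avg R ^^ Suc n) (g s') t) s
      = avg R (\<lambda>t'. avg Q (\<lambda>s'. (avg R ^^ n) (g s') t') s) t"
    using avg_swap[of Q R "\<lambda>s' t'. (avg R ^^ n) (g s') t'" t s] by simp
  then show ?case by (simp add: Suc)
qed simp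

lemma avg_funpow_funpow_swap:
  "(avg Q ^^ m) (\<lambda>s'. (avg R ^^ n) (g s') t) s = (avg R ^^ n) (\<lambda>t'. (avg Q ^^ m) (\<lambda>s'. g s' t') s) t"
proof (induction m arbitrary: s)
  case (Suc m)
  have "(avg Q ^^ Suc m) (\<lambda>s'. (avg R ^^ n) (g s') t) s
      = avg Q (\<lambda>s''. (avg R ^^ n) (\<lambda>t'. (avg Q ^^ m) (\<lambda>s'. g s' t') s'') t) s"
  proof -
    have "(avg Q ^^ m) (\<lambda>s'. (avg R ^^ n) (g s') t)
        = (\<lambda>s''. (avg R ^^ n) (\<lambda>t'. (avg Q ^^ m) (\<lambda>s'. g s' t') s'') t)"
      by (intro ext Suc)
    then show ?thesis by simp
  qed
  also have "\<dots> = (avg R ^^ n) (\<lambda>t'. avg Q (\<lambda>s''. (avg Q ^^ m) (\<lambda>s'. g s' t') s'') s) t"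
    by (rule avg_funpow_swap)
  finally show ?case by simp
qed simp

lemma avg_pair_kernel_funpow:
  "(avg (pair_kernel Q R) ^^ n) g (s, t) = (avg Q ^^ n) (\<lambda>s'. (avg R ^^ n) (\<lambda>t'. g (s', t')) t) s"
proof (induction n arbitrary: s t)
  case (Suc n)
  have "(avg (pair_kernel Q R) ^^ Suc n) g (s, t) =
    avg Q (\<lambda>s'. (avg R ^^ 1) (\<lambda>t'. (avg Q ^^ n) (\<lambda>s''. (avg R ^^ n) (\<lambda>t''. g (s'', t'')) t') s') t) s"
    by (simp add: avg_pair_kernel Suc)
  also have "\<dots> = avg Q (\<lambda>s'. (avg Q ^^ n) (\<lambda>s''. (avg R ^^ 1) (\<lambda>t'. (avg R ^^ n) (\<lambda>t''. g (s'', t'')) t') t) s') s"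
    by (subst avg_funpow_funpow_swap[symmetric]) (rule refl)
  finally show ?case by simp
qed simp

lemma finite_pair_kernel:
  "(\<And>s. finite (set_pmf (Q s))) \<Longrightarrow> (\<And>t. finite (set_pmf (R t))) \<Longrightarrow>
    finite (set_pmf (pair_kernel Q R st))"
  by (auto simp: pair_kernel_def split: prod.split)

text \<open>
  Two steps of the pair are the product of the commuting operators that move one coordinate by two
  steps. Two steps are needed since a walk on a bipartite graph never stays put in one
  step, whereas after two steps it has returned with probability bounded below.
\<close>

lemma two_step_invariant_coordinates:
  fixes Q :: "'s \<Rightarrow> 's pmf" and R :: "'t \<Rightarrow> 't pmf"
  assumes fin: "\<And>s. finite (set_pmf (Q s))" "\<And>t. finite (set_pmf (R t))"
    and "\<epsilon> > 0" and lazy: "\<And>f s. (\<And>t. 0 \<le> f t) \<Longrightarrow> \<epsilon> * f s \<le> avg Q (avg Q f) s"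
    and inv: "avg (pair_kernel Q R) (avg (pair_kernel Q R) g) = g"
    and bdd: "\<And>s. 0 \<le> g s" "\<And>s. g s \<le> 1"
  shows "avg Q (avg Q (\<lambda>s. g (s, t))) = (\<lambda>s. g (s, t))"
    and "avg R (avg R (\<lambda>t. g (s, t))) = (\<lambda>t. g (s, t))"
proof -
  define A where "A = (\<lambda>(f :: 's \<times> 't \<Rightarrow> real) (s, t). avg Q (avg Q (\<lambda>s. f (s, t))) s)"
  define U where "U = (\<lambda>(f :: 's \<times> 't \<Rightarrow> real) (s, t). avg R (avg R (\<lambda>t. f (s, t))) t)"
  have mQ: "markov_op (\<lambda>f. avg Q (avg Q f))" and mR: "markov_op (\<lambda>f. avg R (avg R f))"
    using markov_op_compose[OF markov_op_avg markov_op_avg] fin by blast+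
  have A: "markov_op A"
    unfolding markov_op_def A_def using markov_op_lin[OF mQ] markov_op_nonneg[OF mQ] markov_op_const[OF mQ, of 1]
    by (simp add: split_beta) (simp add: split_beta')
  have U: "markov_op U"
    unfolding markov_op_def U_def using markov_op_lin[OF mR] markov_op_nonneg[OF mR] markov_op_const[OF mR, of 1]
    by (simp add: split_beta) (simp add: split_beta')
  have comm: "A (U f) = U (A f)" for f
    unfolding A_def U_def split_beta fst_conv snd_conv
    by (intro ext) (rule avg_funpow_funpow_swap[of 2 Q 2 R "\<lambda>s t. f (s, t)",
        unfolded numeral_2_eq_2 funpow.simps comp_def id_def])
  have "A (U g) = (avg (pair_kernel Q R) ^^ 2) g"
    using avg_pair_kernel_funpow[of 2 Q R g]
    by (intro ext) (auto simp: A_def U_def numeral_2_eq_2)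
  hence inv': "A (U g) = g" using inv by (simp add: numeral_2_eq_2)
  have lz: "\<epsilon> * f s \<le> A f s" if "\<And>t. 0 \<le> f t" for f s
    using lazy[of "\<lambda>s'. f (s', snd s)" "fst s"] that by (auto simp: A_def split: prod.split)
  note CD = choquet_deny_eq[OF A U comm \<open>\<epsilon> > 0\<close> lz inv' bdd]
  show "avg Q (avg Q (\<lambda>s. g (s, t))) = (\<lambda>s. g (s, t))"
    using CD(1) by (auto simp: A_def fun_eq_iff)
  show "avg R (avg R (\<lambda>t. g (s, t))) = (\<lambda>t. g (s, t))"
    using CD(2) by (auto simp: U_def fun_eq_iff)
qed

section \<open>Markov chains observed through their cylinder probabilities\<close>

text \<open>
  Only the recursion for the probabilities of finite histories is assumed. It makes sense on any
  probability space and needs no construction of a path measure.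
\<close>

locale markov_chain = prob_space N for N :: "'b measure" +
  fixes Y :: "nat \<Rightarrow> 'b \<Rightarrow> 's" and Q :: "'s \<Rightarrow> 's pmf"
  assumes measurable_Y: "\<And>n. Y n \<in> measurable N (count_space UNIV)"
    and finite_Q: "\<And>s. finite (set_pmf (Q s))"
    and prob_step: "\<And>n h. prob {\<omega> \<in> space N. \<forall>k\<le>Suc n. Y k \<omega> = h k}
          = prob {\<omega> \<in> space N. \<forall>k\<le>n. Y k \<omega> = h k} * pmf (Q (h n)) (h (Suc n))"
begin

definition hist :: "nat \<Rightarrow> (nat \<Rightarrow> 's) \<Rightarrow> 'b set" where
  "hist n h = {\<omega> \<in> space N. \<forall>k\<le>n. Y k \<omega> = h k}"

definition visit :: "nat \<Rightarrow> 's set \<Rightarrow> 'b set" where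
  "visit n D = {\<omega> \<in> space N. Y n \<omega> \<in> D}"

text \<open>
  The function \<open>g\<close> is the conditional probability of \<open>B\<close> given the history up to time \<open>n\<close>. The
  product form covers histories of probability zero as well.
\<close>

definition future :: "nat \<Rightarrow> 'b set \<Rightarrow> ('s \<Rightarrow> real) \<Rightarrow> bool" where
  "future n B g \<longleftrightarrow> B \<in> events \<and> (\<forall>h. prob (hist n h \<inter> B) = prob (hist n h) * g (h n))"

lemma visit_event [measurable]: "visit n D \<in> events"
proof -
  have "visit n D = Y n -` D \<inter> space N" by (auto simp: visit_def)
  then show ?thesis using measurable_sets[OF measurable_Y, of D n] by simp
qed

lemma hist_event [measurable]: "hist n h \<in> events"
proof -
  have "hist n h = (\<Inter>k\<in>{..n}. visit k {h k})" by (auto simp: hist_def visit_def)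
  also have "\<dots> \<in> events" by (intro sets.finite_INT) auto
  finally show ?thesis .
qed

lemma prob_hist_Suc: "prob (hist (Suc n) h) = prob (hist n h) * pmf (Q (h n)) (h (Suc n))"
  unfolding hist_def by (rule prob_step)

text \<open>
  The next state lies in the support of the kernel almost surely: the one-step extensions of a history
  already carry its full probability.
\<close>

lemma prob_hist_split:
  assumes B: "B \<in> events"
  shows "prob (hist n h \<inter> B) = (\<Sum>t\<in>set_pmf (Q (h n)). prob (hist (Suc n) (h(Suc n := t)) \<inter> B))"
proof -
  let ?S = "set_pmf (Q (h n))" and ?H = "\<lambda>t. hist (Suc n) (h(Suc n := t))"
  have sub: "?H t \<subseteq> hist n h" for t by (fastforce simp: hist_def)
  have mem: "\<omega> \<in> ?H t \<Longrightarrow> Y (Suc n) \<omega> = t" for \<omega> t by (auto simp: hist_def)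
  have disj: "disjoint_family_on (\<lambda>t. ?H t \<inter> E) ?S" for E
    unfolding disjoint_family_on_def using mem by blast
  have sum: "prob (\<Union>t\<in>?S. ?H t \<inter> E) = (\<Sum>t\<in>?S. prob (?H t \<inter> E))" if "E \<in> events" for E
    using that by (intro finite_measure_finite_Union finite_Q disj) auto
  have "prob (\<Union>t\<in>?S. ?H t) = (\<Sum>t\<in>?S. prob (?H t))"
    using sum[of "space N"] sets.sets_into_space[OF hist_event] by (simp add: Int_absorb2)
  also have "\<dots> = (\<Sum>t\<in>?S. prob (hist n h) * pmf (Q (h n)) t)"
  proof (intro sum.cong refl)
    fix t
    have "hist n (h(Suc n := t)) = hist n h" by (auto simp: hist_def)
    then show "prob (?H t) = prob (hist n h) * pmf (Q (h n)) t" by (simp add: prob_hist_Suc)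
  qed
  also have "\<dots> = prob (hist n h)"
    by (simp add: sum_distrib_left[symmetric] sum_pmf_eq_1[OF finite_Q])
  finally have full: "prob (\<Union>t\<in>?S. ?H t) = prob (hist n h)" .
  have Uev: "(\<Union>t\<in>?S. ?H t) \<in> events" using finite_Q by auto
  define U where "U = (\<Union>t\<in>?S. ?H t)"
  have U: "U \<in> events" "U \<subseteq> hist n h" "prob U = prob (hist n h)"
    using Uev sub full by (auto simp: U_def)
  have "prob (hist n h - U) = 0"
    using finite_measure_Diff[OF hist_event U(1,2)] U(3) by simp
  moreover have "prob ((hist n h - U) \<inter> B) \<le> prob (hist n h - U)"
    by (rule finite_measure_mono) (use U(1) in auto)
  ultimately have z: "prob ((hist n h - U) \<inter> B) = 0"
    using measure_nonneg[of N "(hist n h - U) \<inter> B"] by linarith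
  have "hist n h \<inter> B = (U \<inter> B) \<union> ((hist n h - U) \<inter> B)"
    using U(2) by blast
  also have "prob \<dots> = prob (U \<inter> B) + prob ((hist n h - U) \<inter> B)"
    by (rule finite_measure_Union) (use U(1) B in auto)
  also have "U \<inter> B = (\<Union>t\<in>?S. ?H t \<inter> B)" by (simp add: U_def Int_UN_distrib2)
  finally show ?thesis using z sum[OF B] by simp
qed

text \<open>
  This is the Markov property, read backwards in time. With the closure properties that
  follow it evaluates every event about the future that is needed here.
\<close>

lemma future_step:
  assumes "future (Suc n) B g" shows "future n B (avg Q g)"
  unfolding future_def
proof (intro conjI allI)
  show B: "B \<in> events" using assms by (simp add: future_def)
  fix h
  have "prob (hist n h \<inter> B)
      = (\<Sum>t\<in>set_pmf (Q (h n)). prob (hist (Suc n) (h(Suc n := t))) * g t)"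
    using assms by (subst prob_hist_split[OF B]) (simp add: future_def)
  also have "\<dots> = (\<Sum>t\<in>set_pmf (Q (h n)). prob (hist n h) * (pmf (Q (h n)) t * g t))"
  proof (intro sum.cong refl)
    fix t
    have "hist n (h(Suc n := t)) = hist n h" by (auto simp: hist_def)
    then show "prob (hist (Suc n) (h(Suc n := t))) * g t = prob (hist n h) * (pmf (Q (h n)) t * g t)"
      by (simp add: prob_hist_Suc)
  qed
  finally show "prob (hist n h \<inter> B) = prob (hist n h) * avg Q g (h n)"
    by (simp add: avg_def sum_distrib_left)
qed

lemma future_steps: "future (n + m) B g \<Longrightarrow> future n B ((avg Q ^^ m) g)"
  by (induction m arbitrary: g) (simp, metis add_Suc_right comp_apply funpow_Suc_right future_step)

lemma hist_cases: "hist n h \<inter> visit n D = (if h n \<in> D then hist n h else {})"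
  by (auto simp: hist_def visit_def)

lemma future_visit: "future n (visit n D) (indicator D)"
  by (auto simp: future_def hist_cases)

lemma future_visit_Int: "future n B g \<Longrightarrow> future n (visit n D \<inter> B) (\<lambda>s. indicator D s * g s)"
  using hist_cases[of n _ D] by (auto simp: future_def Int_assoc[symmetric])

lemma future_visit_Un:
  "future n B g \<Longrightarrow> future n (visit n D \<union> B) (\<lambda>s. if s \<in> D then 1 else g s)"
proof -
  assume g: "future n B g"
  have "hist n h \<inter> (visit n D \<union> B) = (if h n \<in> D then hist n h else hist n h \<inter> B)" for h
    using hist_cases[of n h D] by (auto split: if_splits)
  then show ?thesis using g by (auto simp: future_def)
qed

lemma future_incseq:
  assumes "\<And>j. future n (B j) (g j)" "incseq B" "\<And>s. (\<lambda>j. g j s) \<longlonglongrightarrow> g' s"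
  shows "future n (\<Union>j. B j) g'"
  unfolding future_def
proof (intro conjI allI)
  have B: "\<And>j. B j \<in> events" using assms(1) by (simp add: future_def)
  then show "(\<Union>j. B j) \<in> events" by blast
  fix h
  have "(\<lambda>j. prob (hist n h \<inter> B j)) \<longlonglongrightarrow> prob (\<Union>j. hist n h \<inter> B j)"
  proof (rule finite_Lim_measure_incseq)
    show "incseq (\<lambda>j. hist n h \<inter> B j)" using assms(2) unfolding incseq_def by blast
  qed (use B in auto)
  moreover have "(\<lambda>j. prob (hist n h \<inter> B j)) \<longlonglongrightarrow> prob (hist n h) * g' (h n)"
    using assms(1,3) by (auto simp: future_def intro!: tendsto_intros)
  ultimately have "prob (\<Union>j. hist n h \<inter> B j) = prob (hist n h) * g' (h n)"
    by (rule LIMSEQ_unique)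
  then show "prob (hist n h \<inter> (\<Union>j. B j)) = prob (hist n h) * g' (h n)" by (simp only: Int_UN_distrib)
qed

lemma future_decseq:
  assumes "\<And>j. future n (B j) (g j)" "decseq B" "\<And>s. (\<lambda>j. g j s) \<longlonglongrightarrow> g' s"
  shows "future n (\<Inter>j. B j) g'"
  unfolding future_def
proof (intro conjI allI)
  have B: "\<And>j. B j \<in> events" using assms(1) by (simp add: future_def)
  then show "(\<Inter>j. B j) \<in> events" by blast
  fix h
  have "(\<lambda>j. prob (hist n h \<inter> B j)) \<longlonglongrightarrow> prob (\<Inter>j. hist n h \<inter> B j)"
  proof (rule finite_Lim_measure_decseq)
    show "decseq (\<lambda>j. hist n h \<inter> B j)" using assms(2) unfolding decseq_def by blast
  qed (use B in auto)
  moreover have "(\<lambda>j. prob (hist n h \<inter> B j)) \<longlonglongrightarrow> prob (hist n h) * g' (h n)"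
    using assms(1,3) by (auto simp: future_def intro!: tendsto_intros)
  ultimately have "prob (\<Inter>j. hist n h \<inter> B j) = prob (hist n h) * g' (h n)"
    by (rule LIMSEQ_unique)
  moreover have "hist n h \<inter> (\<Inter>j. B j) = (\<Inter>j. hist n h \<inter> B j)" by auto
  ultimately show "prob (hist n h \<inter> (\<Inter>j. B j)) = prob (hist n h) * g' (h n)" by (simp only:)
qed

lemma prob_from_start:
  assumes "AE \<omega> in N. Y 0 \<omega> = s0" "future 0 B g"
  shows "prob B = g s0"
proof -
  have B: "B \<in> events" using assms(2) by (simp add: future_def)
  have eq: "AE \<omega> in N. \<omega> \<in> hist 0 (\<lambda>_. s0)" using assms(1) by (auto simp: hist_def)
  have "prob (hist 0 (\<lambda>_. s0)) = 1" using eq by (subst prob_eq_1) auto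
  moreover have "prob (hist 0 (\<lambda>_. s0) \<inter> B) = prob B"
    using eq B by (intro finite_measure_eq_AE) auto
  ultimately show ?thesis using assms(2) by (simp add: future_def)
qed

subsection \<open>Infinitely many visits\<close>

definition visits_from :: "nat \<Rightarrow> 's set \<Rightarrow> 'b set" where
  "visits_from n D = (\<Union>k\<in>{n..}. visit k D)"

definition inf_visits :: "'s set \<Rightarrow> 'b set" where
  "inf_visits D = (\<Inter>n. visits_from n D)"

lemma inf_visits_eq: "inf_visits D = {\<omega> \<in> space N. infinite {n. Y n \<omega> \<in> D}}"
  unfolding inf_visits_def visits_from_def visit_def infinite_nat_iff_unbounded_le
  by fastforce

lemma visits_from_event [measurable]: "visits_from n D \<in> events"
  unfolding visits_from_def by (intro sets.countable_UN) auto

lemma inf_visits_event [measurable]: "inf_visits D \<in> events"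
  unfolding inf_visits_def by (intro sets.countable_INT) auto

end

text \<open>
  \<open>hit_prob\<close> is the probability of a visit to \<open>D\<close> at some time, time 0 included. Applying
  \<open>n\<close> steps of the kernel to it gives the probability of a visit at time \<open>n\<close> or later, and the limit
  of these is the probability of infinitely many visits. The analytic definitions make
  these quantities available for all starting points at once, although the chain is given for
  one starting point only.
\<close>

fun hit_within :: "('s \<Rightarrow> 's pmf) \<Rightarrow> 's set \<Rightarrow> nat \<Rightarrow> 's \<Rightarrow> real" where
  "hit_within Q D 0 s = indicator D s"
| "hit_within Q D (Suc j) s = (if s \<in> D then 1 else avg Q (hit_within Q D j) s)"

definition hit_prob :: "('s \<Rightarrow> 's pmf) \<Rightarrow> 's set \<Rightarrow> 's \<Rightarrow> real" where
  "hit_prob Q D s = lim (\<lambda>j. hit_within Q D j s)"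

definition inf_prob :: "('s \<Rightarrow> 's pmf) \<Rightarrow> 's set \<Rightarrow> 's \<Rightarrow> real" where
  "inf_prob Q D s = lim (\<lambda>n. (avg Q ^^ n) (hit_prob Q D) s)"

context
  fixes Q :: "'s \<Rightarrow> 's pmf" and D :: "'s set"
  assumes fin: "\<And>s. finite (set_pmf (Q s))"
begin

lemma tendsto_avg:
  "(\<And>s. (\<lambda>j. g j s) \<longlonglongrightarrow> g' s) \<Longrightarrow> (\<lambda>j. avg Q (g j) s) \<longlonglongrightarrow> avg Q g' s"
  unfolding avg_def by (intro tendsto_intros)

lemma avg_markov: "markov_op (avg Q)"
  by (rule markov_op_avg) (rule fin)

lemma avg_funpow_markov: "markov_op (avg Q ^^ n)"
  by (rule markov_op_funpow) (rule avg_markov)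

lemma avg_const: "avg Q (\<lambda>_. c) s = c"
  using markov_op_const[OF avg_markov, of c] by simp

lemma hit_within_bounds: "0 \<le> hit_within Q D j s" "hit_within Q D j s \<le> 1"
proof (induction j arbitrary: s)
  case (Suc j)
  { case 1 show ?case using avg_mono[of Q s "\<lambda>_. 0" "hit_within Q D j"] Suc by (simp add: avg_const) }
  { case 2 show ?case using avg_mono[of Q s "hit_within Q D j" "\<lambda>_. 1"] Suc by (simp add: avg_const) }
qed (auto simp: indicator_def)

lemma hit_within_mono: "hit_within Q D j s \<le> hit_within Q D (Suc j) s"
proof (induction j arbitrary: s)
  case 0 show ?case using hit_within_bounds(1)[of 0] avg_mono[of Q s "\<lambda>_. 0" "hit_within Q D 0"] 
    by (auto simp: avg_const indicator_def)
next
  case (Suc j) then show ?case by (auto intro: avg_mono)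
qed

lemma hit_prob_lim: "(\<lambda>j. hit_within Q D j s) \<longlonglongrightarrow> hit_prob Q D s"
proof -
  have "incseq (\<lambda>j. hit_within Q D j s)" using hit_within_mono by (rule incseq_SucI)
  hence "convergent (\<lambda>j. hit_within Q D j s)"
    using hit_within_bounds by (intro Bseq_mono_convergent) (auto intro!: BseqI'[of _ 1] simp: incseq_def)
  then show ?thesis unfolding hit_prob_def by (simp add: convergent_LIMSEQ_iff)
qed

lemma hit_prob_bounds: "0 \<le> hit_prob Q D s" "hit_prob Q D s \<le> 1"
  using LIMSEQ_le_const[OF hit_prob_lim[of s], of 0] LIMSEQ_le_const2[OF hit_prob_lim[of s], of 1] hit_within_bounds
  by blast+

lemma avg_hit_prob_le: "avg Q (hit_prob Q D) s \<le> hit_prob Q D s"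
proof (cases "s \<in> D")
  case True
  have "hit_prob Q D s = 1"
    by (rule LIMSEQ_unique[OF hit_prob_lim]) (rule LIMSEQ_offset[of _ 1], use True in simp)
  then show ?thesis using avg_mono[of Q s "hit_prob Q D" "\<lambda>_. 1"] hit_prob_bounds by (simp add: avg_const)
next
  case False
  have "(\<lambda>j. avg Q (hit_within Q D j) s) \<longlonglongrightarrow> avg Q (hit_prob Q D) s"
    by (intro tendsto_avg hit_prob_lim)
  moreover have "(\<lambda>j. avg Q (hit_within Q D j) s) \<longlonglongrightarrow> hit_prob Q D s"
    using LIMSEQ_Suc[OF hit_prob_lim[of s]] False by simp
  ultimately show ?thesis using LIMSEQ_unique by fastforce
qed

lemma inf_prob_decreasing:
  "(avg Q ^^ Suc n) (hit_prob Q D) s \<le> (avg Q ^^ n) (hit_prob Q D) s"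
  using markov_op_mono[OF avg_funpow_markov avg_hit_prob_le]
  by (simp add: funpow_Suc_right del: funpow.simps)

lemma inf_prob_pre_bounds:
  "0 \<le> (avg Q ^^ n) (hit_prob Q D) s" "(avg Q ^^ n) (hit_prob Q D) s \<le> 1"
proof -
  show "0 \<le> (avg Q ^^ n) (hit_prob Q D) s"
    by (rule markov_op_nonneg[OF avg_funpow_markov]) (rule hit_prob_bounds)
  have "(avg Q ^^ n) (hit_prob Q D) s \<le> (avg Q ^^ n) (\<lambda>_. 1) s"
    by (rule markov_op_mono[OF avg_funpow_markov]) (rule hit_prob_bounds)
  then show "(avg Q ^^ n) (hit_prob Q D) s \<le> 1" by (simp add: markov_op_const[OF avg_funpow_markov])
qed

lemma inf_prob_lim: "(\<lambda>n. (avg Q ^^ n) (hit_prob Q D) s) \<longlonglongrightarrow> inf_prob Q D s"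
proof -
  have "decseq (\<lambda>n. (avg Q ^^ n) (hit_prob Q D) s)" using inf_prob_decreasing by (rule decseq_SucI)
  hence "convergent (\<lambda>n. (avg Q ^^ n) (hit_prob Q D) s)"
    using inf_prob_pre_bounds
    by (intro Bseq_monoseq_convergent) (auto intro!: BseqI'[of _ 1] simp: decseq_imp_monoseq)
  then show ?thesis unfolding inf_prob_def by (simp add: convergent_LIMSEQ_iff)
qed

lemma inf_prob_bounds: "0 \<le> inf_prob Q D s" "inf_prob Q D s \<le> 1"
  using LIMSEQ_le_const[OF inf_prob_lim[of s], of 0] LIMSEQ_le_const2[OF inf_prob_lim[of s], of 1]
    inf_prob_pre_bounds by blast+

lemma inf_prob_harmonic: "avg Q (inf_prob Q D) = inf_prob Q D"
proof
  fix s
  have "(\<lambda>n. avg Q ((avg Q ^^ n) (hit_prob Q D)) s) \<longlonglongrightarrow> avg Q (inf_prob Q D) s"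
    by (intro tendsto_avg inf_prob_lim)
  then show "avg Q (inf_prob Q D) s = inf_prob Q D s"
    using LIMSEQ_Suc[OF inf_prob_lim[of s]] LIMSEQ_unique by fastforce
qed

end

context markov_chain
begin

lemma future_hit_within: "future n (\<Union>k\<in>{n..n+j}. visit k D) (hit_within Q D j)"
proof (induction j arbitrary: n)
  case 0
  have "hit_within Q D 0 = indicator D" by (rule ext) simp
  then show ?case using future_visit[of n D] by simp
next
  case (Suc j)
  have "{n..n + Suc j} = insert n {Suc n..Suc n + j}" by auto
  hence "(\<Union>k\<in>{n..n + Suc j}. visit k D) = visit n D \<union> (\<Union>k\<in>{Suc n..Suc n + j}. visit k D)" by simp
  moreover have "hit_within Q D (Suc j) = (\<lambda>s. if s \<in> D then 1 else avg Q (hit_within Q D j) s)"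
    by (rule ext) simp
  ultimately show ?case using future_visit_Un[OF future_step[OF Suc[of "Suc n"]], of D] by simp
qed

lemma future_visits_from: "future n (visits_from n D) (hit_prob Q D)"
proof -
  have "visits_from n D = (\<Union>j. \<Union>k\<in>{n..n+j}. visit k D)"
    unfolding visits_from_def by (auto, metis atLeastAtMost_iff le_iff_add order_refl)
  then show ?thesis
    using future_incseq[OF future_hit_within _ hit_prob_lim[OF finite_Q]]
    by (simp add: incseq_def) (metis (no_types, lifting) UN_mono add_left_mono atLeastatMost_subset_iff order_refl)
qed

lemma future_inf_visits: "future n (inf_visits D) (inf_prob Q D)"
proof -
  have dec: "decseq (\<lambda>m. visits_from (n + m) D)"
    by (force simp: decseq_def visits_from_def)
  have "inf_visits D = (\<Inter>m. visits_from (n + m) D)"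
  proof -
    have "visits_from (n + m) D \<subseteq> visits_from m D" for m by (force simp: visits_from_def)
    then show ?thesis unfolding inf_visits_def by blast
  qed
  then show ?thesis
    using future_decseq[OF future_steps[OF future_visits_from] dec inf_prob_lim[OF finite_Q]] by simp
qed

text \<open>
  Let \<open>A\<close> be the event of infinitely many visits. If its conditional probability given any history
  is \<open>c\<close>, then \<open>A\<close> is independent of every event determined by a finite history, such as a visit
  between times \<open>m\<close> and \<open>m + j\<close>. These events approximate \<open>A\<close> itself as \<open>j\<close> and then \<open>m\<close> tend to
  infinity, so \<open>A\<close> is independent of itself.
\<close>

lemma zero_one_law:
  assumes start: "AE \<omega> in N. Y 0 \<omega> = s0"
    and const: "\<And>n h. prob (hist n h) > 0 \<Longrightarrow> h 0 = s0 \<Longrightarrow> inf_prob Q D (h n) = c"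
  shows "prob (inf_visits D) = 0 \<or> prob (inf_visits D) = 1"
proof -
  let ?A = "inf_visits D"
  have pos: "prob (hist n h) > 0 \<Longrightarrow> h 0 = s0" for n h
  proof (rule ccontr)
    assume "prob (hist n h) > 0" "h 0 \<noteq> s0"
    have "AE \<omega> in N. \<omega> \<notin> hist n h" using start by eventually_elim (use \<open>h 0 \<noteq> s0\<close> in \<open>auto simp: hist_def\<close>)
    hence "prob (hist n h) = 0" by (subst prob_eq_0) auto
    then show False using \<open>prob (hist n h) > 0\<close> by simp
  qed
  have A: "prob (hist n h \<inter> ?A) = c * prob (hist n h)" for n h
  proof (cases "prob (hist n h) > 0")
    case True then show ?thesis
      using future_inf_visits[of n D] const[OF True pos[OF True]] by (simp add: future_def)
  next
    case False
    hence z: "prob (hist n h) = 0" using measure_nonneg[of N "hist n h"] by linarith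
    then show ?thesis
      using finite_measure_mono[of "hist n h \<inter> ?A" "hist n h"] measure_nonneg[of N "hist n h \<inter> ?A"] by simp
  qed
  \<comment> \<open>both sides split in the same way over the next state, and at the horizon \<open>L\<close> the event \<open>B\<close> is decided\<close>
  have B: "prob (hist k h \<inter> (B \<inter> ?A)) = c * prob (hist k h \<inter> B)"
    if "\<And>h. hist L h \<inter> B = {} \<or> hist L h \<subseteq> B" "B \<in> events" "k \<le> L" for k h B L
    using that(3)
  proof (induction k arbitrary: h rule: inc_induct)
    case base
    have "prob (hist L h \<inter> B \<inter> ?A) = c * prob (hist L h \<inter> B)"
    proof (cases "hist L h \<inter> B = {}")
      case False
      hence "hist L h \<inter> B = hist L h" using that(1)[of h] by blast
      then show ?thesis by (simp add: A)
    qed simp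
    then show ?case by (simp add: Int_assoc)
  next
    case (step k)
    have "B \<inter> ?A \<in> events" using that(2) by auto
    then show ?case
      by (subst (1 2) prob_hist_split) (simp_all only: that(2) step.IH sum_distrib_left)
  qed
  have all: "prob (hist 0 (\<lambda>_. s0) \<inter> E) = prob E" if "E \<in> events" for E
  proof (rule finite_measure_eq_AE)
    show "AE \<omega> in N. (\<omega> \<in> hist 0 (\<lambda>_. s0) \<inter> E) = (\<omega> \<in> E)"
      using start by (auto simp: hist_def)
  qed (use that in auto)
  have fin: "prob ((\<Union>k\<in>{m..m+j}. visit k D) \<inter> ?A) = c * prob (\<Union>k\<in>{m..m+j}. visit k D)" for m j
  proof -
    have "hist (m+j) h \<inter> (\<Union>k\<in>{m..m+j}. visit k D) = {} \<or> hist (m+j) h \<subseteq> (\<Union>k\<in>{m..m+j}. visit k D)" for h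
    proof (cases "\<exists>k\<in>{m..m+j}. h k \<in> D")
      case True then show ?thesis by (fastforce simp: hist_def visit_def)
    next
      case False then show ?thesis by (force simp: hist_def visit_def)
    qed
    from B[OF this, of 0 "\<lambda>_. s0"] show ?thesis by (auto simp: all)
  qed
  have "prob (visits_from m D \<inter> ?A) = c * prob (visits_from m D)" for m
  proof -
    define F where "F = (\<lambda>j. (\<Union>k\<in>{m..m+j}. visit k D))"
    have [measurable]: "F j \<in> events" for j unfolding F_def by auto
    have U: "visits_from m D = (\<Union>j. F j)"
      unfolding visits_from_def F_def by (auto, metis atLeastAtMost_iff le_iff_add order_refl)
    have inc: "incseq F" unfolding F_def by (force simp: incseq_def)
    have "(\<lambda>j. prob (F j)) \<longlonglongrightarrow> prob (\<Union>j. F j)"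
      using inc by (intro finite_Lim_measure_incseq) auto
    hence "(\<lambda>j. c * prob (F j)) \<longlonglongrightarrow> c * prob (\<Union>j. F j)" by (intro tendsto_intros)
    moreover have "(\<lambda>j. prob (F j \<inter> ?A)) \<longlonglongrightarrow> prob (\<Union>j. F j \<inter> ?A)"
    proof (rule finite_Lim_measure_incseq)
      show "incseq (\<lambda>j. F j \<inter> ?A)" using inc unfolding incseq_def by (meson Int_mono order_refl)
    qed auto
    moreover have "(\<lambda>j. c * prob (F j)) = (\<lambda>j. prob (F j \<inter> ?A))"
      using fin[of m] by (simp add: F_def)
    ultimately have "prob (\<Union>j. F j \<inter> ?A) = c * prob (\<Union>j. F j)"
      by (metis LIMSEQ_unique)
    moreover have "(\<Union>j. F j) \<inter> ?A = (\<Union>j. F j \<inter> ?A)" by blast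
    ultimately show ?thesis unfolding U by (simp only:)
  qed
  moreover have "visits_from m D \<inter> ?A = ?A" for m unfolding inf_visits_def by blast
  ultimately have v: "prob ?A = c * prob (visits_from m D)" for m by metis
  have "(\<lambda>m. prob (visits_from m D)) \<longlonglongrightarrow> prob ?A"
    unfolding inf_visits_def by (rule finite_Lim_measure_decseq) (force simp: decseq_def visits_from_def)+
  hence "(\<lambda>m. c * prob (visits_from m D)) \<longlonglongrightarrow> c * prob ?A" by (intro tendsto_intros)
  hence "prob ?A = c * prob ?A" unfolding v[symmetric] by (simp add: LIMSEQ_const_iff)
  moreover have "prob ?A = c" using A[of 0 "\<lambda>_. s0"] all[of ?A] all[of "space N"] sets.sets_into_space[OF hist_event, of 0 "\<lambda>_. s0"] by (simp add: prob_space Int_absorb2)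
  ultimately show ?thesis by auto
qed

end

context markov_chain
begin

subsection \<open>Second moment method\<close>

lemma prob_visit:
  assumes "AE \<omega> in N. Y 0 \<omega> = s0"
  shows "prob (visit n D) = (avg Q ^^ n) (indicator D) s0"
  using prob_from_start[OF assms future_steps[of 0 n]] future_visit by simp

lemma prob_two_visits_le:
  assumes start: "AE \<omega> in N. Y 0 \<omega> = s0" and b: "\<And>s. s \<in> D \<Longrightarrow> (avg Q ^^ m) (indicator D) s \<le> b"
  shows "prob (visit n D \<inter> visit (n + m) D) \<le> b * prob (visit n D)"
proof -
  note op = markov_op_funpow[OF markov_op_avg[OF finite_Q], of n]
  have "prob (visit n D \<inter> visit (n + m) D)
      = (avg Q ^^ n) (\<lambda>s. indicator D s * (avg Q ^^ m) (indicator D) s) s0"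
    using prob_from_start[OF start future_steps[of 0 n]] future_visit_Int[OF future_steps[OF future_visit]]
    by simp
  also have "\<dots> \<le> (avg Q ^^ n) (\<lambda>s. b * indicator D s) s0"
    by (rule markov_op_mono[OF op]) (use b in \<open>auto simp: indicator_def\<close>)
  also have "\<dots> = b * prob (visit n D)"
    by (simp add: markov_op_scale[OF op] prob_visit[OF start])
  finally show ?thesis .
qed

text \<open>
  Let \<open>Z\<close> count the visits up to time \<open>n\<close> and \<open>H = harm n\<close>. The upper bound on returns gives
  \<open>E Z\<^sup>2 \<le> 4 C H E Z\<close>, and \<open>E Z \<ge> \<kappa> H\<close> for infinitely many \<open>n\<close>. As in the Paley--Zygmund
  inequality, \<open>Z\<close> then exceeds a fixed fraction of \<open>H\<close> with probability bounded below. Since \<open>H\<close> is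
  unbounded, such a \<open>Z\<close> forces visits after any given time.
\<close>

lemma inf_visits_pos:
  fixes \<kappa> C :: real
  assumes start: "AE \<omega> in N. Y 0 \<omega> = s0"
    and upper: "\<And>m s. s \<in> D \<Longrightarrow> m \<ge> 1 \<Longrightarrow> (avg Q ^^ m) (indicator D) s \<le> C / real m"
    and C: "C \<ge> 1" and "\<kappa> > 0"
    and lower: "\<exists>\<^sub>F n in sequentially. \<kappa> * harm n \<le> (\<Sum>k=1..n. (avg Q ^^ k) (indicator D) s0)"
  shows "prob (inf_visits D) > 0"
proof -
  have ind: "integrable N (indicat_real A)" if "A \<in> events" for A
    using that by (intro integrable_real_indicator) (auto simp: less_top[symmetric])
  define p where "p n = prob (visit n D)" for n
  have p_nonneg: "0 \<le> p n" for n by (simp add: p_def)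
  define b where "b j = (if j = 0 then 1 else C / real j)" for j :: nat
  have b_nonneg: "0 \<le> b j" for j using C by (simp add: b_def)
  have pair: "prob (visit n D \<inter> visit (n + m) D) \<le> b m * p n" for n m
    unfolding p_def
    by (rule prob_two_visits_le[OF start]) (auto simp: b_def upper indicator_def)
  have "\<kappa> / (8 * C) \<le> prob (visits_from m D)" for m
  proof -
    have "filterlim (\<lambda>n. \<kappa> / 4 * harm n :: real) at_top sequentially"
      using \<open>\<kappa> > 0\<close> by (intro filterlim_tendsto_pos_mult_at_top[OF tendsto_const _ harm_at_top]) auto
    hence "\<forall>\<^sub>F n in sequentially. real m \<le> \<kappa> / 4 * harm n"
      unfolding filterlim_at_top by blast
    hence "\<forall>\<^sub>F n in sequentially. real m \<le> \<kappa> / 4 * harm n \<and> n \<ge> 1"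
      using eventually_ge_at_top[of "1::nat"] by (rule eventually_conj)
    from frequently_ex[OF frequently_eventually_frequently[OF lower this]]
    obtain n where n: "n \<ge> 1" "real m \<le> \<kappa> / 4 * harm n"
        "\<kappa> * harm n \<le> (\<Sum>k=1..n. (avg Q ^^ k) (indicator D) s0)"
      by blast
    define H where "H = (harm n :: real)"
    have "(\<Sum>k=1..1. inverse (real k)) \<le> (\<Sum>k=1..n. inverse (real k))"
      using n(1) by (intro sum_mono2) auto
    hence H: "H \<ge> 1" by (simp add: H_def harm_def)
    define e where "e = (\<Sum>k=1..n. p k)"
    have e: "\<kappa> * H \<le> e" using n(3) by (simp add: e_def p_def prob_visit[OF start] H_def)
    define Z where "Z \<omega> = (\<Sum>k=1..n. indicator (visit k D) \<omega> :: real)" for \<omega>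
    have Zint: "integrable N Z" unfolding Z_def by (intro Bochner_Integration.integrable_sum ind) auto
    have EZ: "expectation Z = e"
      unfolding Z_def e_def p_def by (subst Bochner_Integration.integral_sum) (auto intro: ind)
    have Zsq: "(Z \<omega>)\<^sup>2 = (\<Sum>k=1..n. \<Sum>l=1..n. indicator (visit k D \<inter> visit l D) \<omega>)" for \<omega>
      by (simp add: Z_def power2_eq_square sum_product indicator_inter_arith)
    have Z2int: "integrable N (\<lambda>\<omega>. (Z \<omega>)\<^sup>2)" unfolding Zsq by (intro Bochner_Integration.integrable_sum ind) auto
    have "(\<Sum>j=0..n. b j) = 1 + (\<Sum>j=1..n. C / real j)"
      by (subst sum.atLeast_Suc_atMost) (auto simp: b_def)
    also have "(\<Sum>j=1..n. C / real j) = C * H"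
      by (simp add: H_def harm_def sum_distrib_left divide_inverse)
    also have "1 + C * H \<le> 2 * C * H"
      using mult_mono[OF C H] C by simp
    finally have sb: "(\<Sum>j=0..n. b j) \<le> 2 * C * H" .
    have row: "(\<Sum>l=k..n. prob (visit k D \<inter> visit l D)) \<le> 2 * C * H * p k" for k
    proof -
      have "(\<Sum>l=k..n. prob (visit k D \<inter> visit l D)) \<le> (\<Sum>l=k..n. b (l - k) * p k)"
      proof (rule sum_mono)
        fix l assume "l \<in> {k..n}"
        then show "prob (visit k D \<inter> visit l D) \<le> b (l - k) * p k" using pair[of k "l - k"] by simp
      qed
      also have "\<dots> = (\<Sum>l\<in>(\<lambda>l. l - k) ` {k..n}. b l) * p k"
        by (subst sum.reindex) (auto simp: inj_on_def sum_distrib_right)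
      also have "\<dots> \<le> (\<Sum>l=0..n. b l) * p k"
        by (intro mult_right_mono sum_mono2) (auto simp: b_nonneg p_nonneg)
      also have "\<dots> \<le> 2 * C * H * p k" by (intro mult_right_mono sb p_nonneg)
      finally show ?thesis .
    qed
    have "expectation (\<lambda>\<omega>. (Z \<omega>)\<^sup>2) = (\<Sum>k=1..n. \<Sum>l=1..n. prob (visit k D \<inter> visit l D))"
      unfolding Zsq by (simp add: Bochner_Integration.integral_sum Bochner_Integration.integrable_sum ind)
    also have "\<dots> \<le> (\<Sum>k=1..n. \<Sum>l=1..n. (if k \<le> l then prob (visit k D \<inter> visit l D) else 0)
        + (if l \<le> k then prob (visit l D \<inter> visit k D) else 0))"
      by (intro sum_mono) (auto simp: Int_commute)
    also have "\<dots> = 2 * (\<Sum>k=1..n. \<Sum>l=1..n. (if k \<le> l then prob (visit k D \<inter> visit l D) else 0))"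
      by (simp add: sum.distrib) (subst sum.swap, rule refl)
    also have "\<dots> = 2 * (\<Sum>k=1..n. \<Sum>l=k..n. prob (visit k D \<inter> visit l D))"
    proof -
      have "(\<Sum>l=1..n. (if k \<le> l then prob (visit k D \<inter> visit l D) else 0)) = (\<Sum>l=k..n. prob (visit k D \<inter> visit l D))"
        if "k \<in> {1..n}" for k
        by (rule sum.mono_neutral_cong_right) (use that in auto)
      then show ?thesis by simp
    qed
    also have "\<dots> \<le> 2 * (\<Sum>k=1..n. 2 * C * H * p k)" by (intro mult_left_mono sum_mono row) auto
    also have "\<dots> = 4 * C * H * e" by (simp add: e_def sum_distrib_left mult.assoc)
    finally have EZ2: "expectation (\<lambda>\<omega>. (Z \<omega>)\<^sup>2) \<le> 4 * C * H * e" .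
    define a where "a = \<kappa> / 4 * H"
    define G where "G = {\<omega> \<in> space N. a < Z \<omega>}"
    have Zm: "Z \<in> borel_measurable N" using Zint by auto
    have G: "G \<in> events" unfolding G_def using Zm by measurable
    have CH: "C * H > 0" using C H by simp
    \<comment> \<open>linearised Cauchy--Schwarz; this value of \<open>\<eta>\<close> makes the second moment cost a quarter of the mean\<close>
    define \<eta> where "\<eta> = 1 / (16 * (C * H))"
    have \<eta>: "\<eta> > 0" using CH by (simp add: \<eta>_def)
    have pt: "Z \<omega> \<le> a + \<eta> * (Z \<omega>)\<^sup>2 + 1 / (4 * \<eta>) * indicator G \<omega>" if "\<omega> \<in> space N" for \<omega>
    proof (cases "\<omega> \<in> G")
      case True
      have "a \<ge> 0" using \<open>\<kappa> > 0\<close> H by (simp add: a_def)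
      have "0 \<le> (2 * \<eta> * Z \<omega> - 1)\<^sup>2" by simp
      hence "4 * \<eta> * Z \<omega> \<le> 4 * \<eta> * (\<eta> * (Z \<omega>)\<^sup>2 + 1 / (4 * \<eta>))"
        using \<eta> by (simp add: power2_eq_square algebra_simps)
      hence "Z \<omega> \<le> \<eta> * (Z \<omega>)\<^sup>2 + 1 / (4 * \<eta>)" using \<eta> by (simp add: mult_le_cancel_left)
      then show ?thesis using True \<open>a \<ge> 0\<close> by simp
    next
      case False
      then show ?thesis using that \<eta> by (simp add: G_def add_increasing2)
    qed
    have "expectation Z \<le> expectation (\<lambda>\<omega>. a + \<eta> * (Z \<omega>)\<^sup>2 + 1 / (4 * \<eta>) * indicator G \<omega>)"
      by (rule integral_mono) (use pt Zint Z2int ind[OF G] in auto)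
    also have "\<dots> = a + \<eta> * expectation (\<lambda>\<omega>. (Z \<omega>)\<^sup>2) + 1 / (4 * \<eta>) * prob G"
      using Z2int ind[OF G] G by (simp add: prob_space)
    also have "\<dots> \<le> a + \<eta> * (4 * C * H * e) + 1 / (4 * \<eta>) * prob G"
      using EZ2 \<eta> by (intro add_mono mult_left_mono) auto
    also have "\<eta> * (4 * C * H * e) = e / 4" using C H by (simp add: \<eta>_def)
    also have "1 / (4 * \<eta>) * prob G = 4 * (C * H) * prob G" by (simp add: \<eta>_def)
    finally have "e \<le> a + e / 4 + 4 * (C * H) * prob G" by (simp add: EZ)
    moreover have "8 * C * prob G * H = 2 * (4 * (C * H) * prob G)" by simp
    ultimately have "\<kappa> * H \<le> (8 * C * prob G) * H" using e unfolding a_def by linarith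
    hence "\<kappa> \<le> 8 * C * prob G" using H by (simp add: mult_le_cancel_right)
    hence "\<kappa> / (8 * C) \<le> prob G" using C by (simp add: field_simps)
    also have "G \<subseteq> visits_from m D"
    proof
      fix \<omega> assume w: "\<omega> \<in> G"
      show "\<omega> \<in> visits_from m D"
      proof (rule ccontr)
        assume no: "\<omega> \<notin> visits_from m D"
        have "Z \<omega> \<le> (\<Sum>k=1..n. if k < m then 1 else 0)"
          unfolding Z_def by (intro sum_mono) (use no in \<open>auto simp: visits_from_def indicator_def\<close>)
        also have "\<dots> = real (card {k \<in> {1..n}. k < m})" by (simp add: sum.If_cases Int_def)
        also have "\<dots> \<le> real (card {..<m})" by (intro of_nat_mono card_mono) auto
        also have "\<dots> \<le> a" using n(2) by (simp add: a_def H_def)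
        finally show False using w by (simp add: G_def)
      qed
    qed
    hence "prob G \<le> prob (visits_from m D)" by (intro finite_measure_mono) auto
    finally show ?thesis .
  qed
  moreover have "(\<lambda>m. prob (visits_from m D)) \<longlonglongrightarrow> prob (inf_visits D)"
    unfolding inf_visits_def by (rule finite_Lim_measure_decseq) (force simp: decseq_def visits_from_def)+
  ultimately have "\<kappa> / (8 * C) \<le> prob (inf_visits D)" by (intro LIMSEQ_le_const) auto
  moreover have "\<kappa> / (8 * C) > 0" using \<open>\<kappa> > 0\<close> C by simp
  ultimately show ?thesis by linarith
qed

end

section \<open>The comb\<close>

locale comb =
  fixes F :: "int \<Rightarrow> real"
  assumes F_nonneg: "0 \<le> F x"
begin

abbreviation V :: "(int \<times> int) set" where "V \<equiv> comb_vertices F"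

definition nb :: "int \<times> int \<Rightarrow> (int \<times> int) set" where
  "nb v = neighbours (comb_edges F) v"

definition deg :: "int \<times> int \<Rightarrow> real" where "deg v = real (card (nb v))"

text \<open>
  A walker outside the comb stays where it is. So the kernel is defined everywhere and its averaging
  operator is a Markov operator on all functions on the lattice.
\<close>

definition K :: "int \<times> int \<Rightarrow> (int \<times> int) pmf" where
  "K v = (if v \<in> V then pmf_of_set (nb v) else return_pmf v)"

abbreviation T :: "(int \<times> int \<Rightarrow> real) \<Rightarrow> int \<times> int \<Rightarrow> real" where "T \<equiv> avg K"

text \<open>
  This is the graph Laplacian without division by the degree, so that contributions of edges simply
  add up.
\<close>

definition lap :: "(int \<times> int \<Rightarrow> real) \<Rightarrow> int \<times> int \<Rightarrow> real" where
  "lap g v = (\<Sum>u\<in>nb v. g u - g v)"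

lemma V_iff: "(x, y) \<in> V \<longleftrightarrow> - F x \<le> real_of_int y \<and> real_of_int y \<le> F x"
  by (simp add: comb_vertices_def)

lemma spine_in_V [simp]: "(x, 0) \<in> V"
  using F_nonneg[of x] by (simp add: V_iff)

lemma nb_eq:
  assumes "(x, y) \<in> V"
  shows "nb (x, y) = (if (x, y + 1) \<in> V then {(x, y + 1)} else {}) \<union>
    (if (x, y - 1) \<in> V then {(x, y - 1)} else {}) \<union>
    (if y = 0 then {(x + 1, 0), (x - 1, 0)} else {})"
proof -
  have "u \<in> nb (x, y) \<longleftrightarrow> u \<in> V \<and> ((fst u = x \<and> \<bar>snd u - y\<bar> = 1) \<or> (y = 0 \<and> snd u = 0 \<and> \<bar>fst u - x\<bar> = 1))" for u
    using assms by (cases u) (auto simp: nb_def neighbours_def comb_edges_def doubleton_eq_iff abs_minus_commute)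
  moreover have "\<bar>a - b\<bar> = 1 \<longleftrightarrow> a = b + 1 \<or> a = b - 1" for a b :: int by linarith
  ultimately show ?thesis by (auto simp: set_eq_iff split: if_splits)
qed

lemma finite_nb: "v \<in> V \<Longrightarrow> finite (nb v)"
  by (cases v) (simp add: nb_eq)

lemma nb_subset: "v \<in> V \<Longrightarrow> u \<in> nb v \<Longrightarrow> u \<in> V"
  by (cases v) (auto simp: nb_eq split: if_splits)

lemma nb_sym: "u \<in> nb v \<longleftrightarrow> v \<in> nb u"
  by (simp add: nb_def neighbours_def insert_commute)

lemma tooth_down:
  assumes "(x, y) \<in> V" "y > 0" shows "(x, y - 1) \<in> V"
  using assms by (auto simp: V_iff)

lemma tooth_up:
  assumes "(x, y) \<in> V" "y < 0" shows "(x, y + 1) \<in> V"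
  using assms by (auto simp: V_iff)

lemma nb_nonempty: "v \<in> V \<Longrightarrow> nb v \<noteq> {}"
proof (cases v)
  case (Pair x y)
  assume "v \<in> V"
  then show ?thesis
    using tooth_down[of x y] tooth_up[of x y] Pair by (cases "y = 0"; cases "y > 0") (auto simp: nb_eq)
qed

lemma deg_bounds: assumes "v \<in> V" shows "1 \<le> deg v" "deg v \<le> 4"
proof -
  show "1 \<le> deg v" using finite_nb[OF assms] nb_nonempty[OF assms]
    by (simp add: deg_def Suc_le_eq card_gt_0_iff)
  obtain x y where v: "v = (x, y)" by (cases v)
  have "nb v \<subseteq> {(x, y+1), (x, y-1), (x+1, 0), (x-1, 0)}"
    using assms by (auto simp: v nb_eq split: if_splits)
  hence "card (nb v) \<le> card {(x, y+1), (x, y-1), (x+1, 0), (x-1, 0)}" by (intro card_mono) auto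
  also have "\<dots> \<le> 4" by (rule order_trans[OF card_insert_le_m1])
      (auto intro!: order_trans[OF card_insert_le_m1])
  finally show "deg v \<le> 4" by (simp add: deg_def)
qed

lemma set_K: "set_pmf (K v) = (if v \<in> V then nb v else {v})"
  by (simp add: K_def finite_nb nb_nonempty)

lemma finite_K: "finite (set_pmf (K v))"
  by (simp add: set_K finite_nb)

lemma op_T: "markov_op T" by (rule markov_op_avg) (rule finite_K)

lemma op_Tn: "markov_op (T ^^ n)" by (rule markov_op_funpow[OF op_T])

lemma T_V: "v \<in> V \<Longrightarrow> T g v = (\<Sum>u\<in>nb v. g u) / deg v"
  by (auto simp: avg_def K_def finite_nb nb_nonempty deg_def sum_divide_distrib intro!: sum.cong)

lemma T_outside: "v \<notin> V \<Longrightarrow> T g v = g v"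
  by (simp add: avg_def K_def)

lemma T_lap: assumes "v \<in> V" shows "T g v = g v + lap g v / deg v"
proof -
  have "deg v \<noteq> 0" using deg_bounds(1)[OF assms] by simp
  then show ?thesis
    by (simp add: T_V[OF assms] lap_def sum_subtractf deg_def diff_divide_distrib)
qed

lemma lap_eq:
  assumes "(x, y) \<in> V"
  shows "lap g (x, y) = (if (x, y + 1) \<in> V then g (x, y + 1) - g (x, y) else 0) +
    (if (x, y - 1) \<in> V then g (x, y - 1) - g (x, y) else 0) +
    (if y = 0 then g (x + 1, 0) - g (x, 0) + (g (x - 1, 0) - g (x, 0)) else 0)"
  unfolding lap_def nb_eq[OF assms] by (cases "y = 0") auto

lemma Tn_mono_on_V:
  assumes "\<And>u. u \<in> V \<Longrightarrow> f u \<le> g u" "v \<in> V" shows "(T ^^ n) f v \<le> (T ^^ n) g v"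
  using assms(2)
proof (induction n arbitrary: v)
  case 0 then show ?case using assms(1) by simp
next
  case (Suc n)
  have "T ((T ^^ n) f) v \<le> T ((T ^^ n) g) v"
    by (rule avg_mono) (use Suc nb_subset in \<open>auto simp: set_K\<close>)
  then show ?case by simp
qed

text \<open>
  All degrees are at most four, so whichever neighbour is chosen first, the second step leads
  back with probability at least one quarter.
\<close>

lemma T_lazy:
  assumes "\<And>u. 0 \<le> f u" shows "1 / 4 * f v \<le> T (T f) v"
proof (cases "v \<in> V")
  case True
  have "f v / 4 \<le> T f u" if u: "u \<in> nb v" for u
  proof -
    have "u \<in> V" using nb_subset[OF True u] .
    note d = deg_bounds[OF this]
    have "f v \<le> (\<Sum>w\<in>nb u. f w)"
      using u assms by (intro member_le_sum) (auto simp: nb_sym[of v] finite_nb \<open>u \<in> V\<close>)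
    hence "f v / deg u \<le> (\<Sum>w\<in>nb u. f w) / deg u" using d by (intro divide_right_mono) auto
    moreover have "f v / 4 \<le> f v / deg u" using d assms[of v] by (intro divide_left_mono) auto
    ultimately show ?thesis unfolding T_V[OF \<open>u \<in> V\<close>] by linarith
  qed
  hence "T (\<lambda>_. f v / 4) v \<le> T (T f) v" by (intro avg_mono) (auto simp: set_K True)
  then show ?thesis by (simp add: markov_op_const[OF op_T])
next
  case False then show ?thesis using assms[of v] by (simp add: T_outside)
qed

subsection \<open>Bounded harmonic functions\<close>

text \<open>
  At the tip of a tooth the only neighbour carries the same value; harmonicity then transports
  equality from each edge of the tooth to the next one towards the spine.
\<close>

lemma harmonic_const_on_teeth:
  assumes harm: "\<And>v. v \<in> V \<Longrightarrow> lap g v = 0" and "(x, y) \<in> V"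
  shows "g (x, y) = g (x, 0)"
proof -
  have up: "g (x, y) = g (x, y - 1)" if "(x, y) \<in> V" "y \<ge> 1" for y
    using that
  proof (induction "nat (\<lfloor>F x\<rfloor> - y)" arbitrary: y rule: less_induct)
    case less
    have 0: "lap g (x, y) = 0" using harm less.prems by simp
    have d: "(x, y - 1) \<in> V" using tooth_down less.prems by simp
    show ?case
    proof (cases "(x, y + 1) \<in> V")
      case True
      hence "y + 1 \<le> \<lfloor>F x\<rfloor>" by (simp add: V_iff le_floor_iff)
      hence "g (x, y + 1) = g (x, y)" using less.hyps[of "y + 1"] True less.prems by simp
      then show ?thesis using 0 d less.prems by (simp add: lap_eq True)
    next
      case False then show ?thesis using 0 d less.prems by (simp add: lap_eq)
    qed
  qed
  have down: "g (x, y) = g (x, y + 1)" if "(x, y) \<in> V" "y \<le> -1" for y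
    using that
  proof (induction "nat (\<lfloor>F x\<rfloor> + y)" arbitrary: y rule: less_induct)
    case less
    have 0: "lap g (x, y) = 0" using harm less.prems by simp
    have d: "(x, y + 1) \<in> V" using tooth_up less.prems by simp
    show ?case
    proof (cases "(x, y - 1) \<in> V")
      case True
      hence "1 - y \<le> \<lfloor>F x\<rfloor>" by (simp add: V_iff le_floor_iff)
      hence "g (x, y - 1) = g (x, y)" using less.hyps[of "y - 1"] True less.prems by simp
      then show ?thesis using 0 d less.prems by (simp add: lap_eq True)
    next
      case False then show ?thesis using 0 d less.prems by (simp add: lap_eq)
    qed
  qed
  have "(x, int n) \<in> V \<Longrightarrow> g (x, int n) = g (x, 0)" for n
  proof (induction n)
    case (Suc n)
    then show ?case using up[of "int (Suc n)"] tooth_down[of x "int (Suc n)"] by simp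
  qed simp
  moreover have "(x, - int n) \<in> V \<Longrightarrow> g (x, - int n) = g (x, 0)" for n
  proof (induction n)
    case (Suc n)
    then show ?case using down[of "- int (Suc n)"] tooth_up[of x "- int (Suc n)"] by simp
  qed simp
  ultimately show ?thesis using \<open>(x, y) \<in> V\<close> by (cases y rule: int_cases2) auto
qed

text \<open>
  As the teeth contribute nothing to the Laplacian at the spine, the restriction to the spine is
  affine, hence constant if bounded.
\<close>

lemma bounded_harmonic_const:
  assumes harm: "\<And>v. v \<in> V \<Longrightarrow> T g v = g v" and bdd: "\<And>v. \<bar>g v\<bar> \<le> B" and "v \<in> V"
  shows "g v = g (0, 0)"
proof -
  have lap: "lap g v = 0" if "v \<in> V" for v
    using harm[OF that] T_lap[OF that, of g] deg_bounds(1)[OF that] by simp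
  have teeth: "g (x, y) = g (x, 0)" if "(x, y) \<in> V" for x y
    by (rule harmonic_const_on_teeth[OF lap that])
  have step: "g (x + 1, 0) - g (x, 0) = g (x, 0) - g (x - 1, 0)" for x
    using lap[of "(x, 0)"] teeth[of x 1] teeth[of x "-1"] by (simp add: lap_eq split: if_splits)
  define d where "d = g (1, 0) - g (0, 0)"
  have inc: "g (x + 1, 0) - g (x, 0) = d" for x
  proof (induction x rule: int_induct[of _ 0])
    case (step1 i) then show ?case using step[of "i + 1"] by simp
  next
    case (step2 i) then show ?case using step[of i] by simp
  qed (simp add: d_def)
  have lin: "g (x, 0) = g (0, 0) + real_of_int x * d" for x
  proof (induction x rule: int_induct[of _ 0])
    case (step1 i) then show ?case using inc[of i] by (simp add: algebra_simps)
  next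
    case (step2 i) then show ?case using inc[of "i - 1"] by (simp add: algebra_simps)
  qed simp
  have "d = 0"
  proof (rule ccontr)
    assume "d \<noteq> 0"
    then obtain n where n: "real n * \<bar>d\<bar> > 2 * B" using reals_Archimedean3[of "\<bar>d\<bar>"] by auto
    have "real n * \<bar>d\<bar> = \<bar>g (int n, 0) - g (0, 0)\<bar>" using lin[of "int n"] by (simp add: abs_mult)
    also have "\<dots> \<le> 2 * B" using bdd[of "(int n, 0)"] bdd[of "(0, 0)"] by linarith
    finally show False using n by simp
  qed
  then show ?thesis using lin[of "fst v"] teeth[of "fst v" "snd v"] \<open>v \<in> V\<close> by simp
qed

definition parity :: "int \<times> int \<Rightarrow> bool" where "parity v = even (fst v + snd v)"

lemma parity_nb: "v \<in> V \<Longrightarrow> u \<in> nb v \<Longrightarrow> parity u \<longleftrightarrow> \<not> parity v"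
  by (cases v) (auto simp: nb_eq parity_def split: if_splits)

text \<open>
  The function \<open>g + T g\<close> is harmonic. So is \<open>g - T g\<close> after multiplication by the sign
  that alternates with the parity, because \<open>T\<close> negates \<open>g - T g\<close> and every step changes the parity.
  Both are bounded, hence constant, and they determine \<open>g\<close> up to parity.
\<close>

lemma two_step_harmonic_parity:
  assumes inv: "T (T g) = g" and bdd: "\<And>v. 0 \<le> g v" "\<And>v. g v \<le> 1"
    and "v \<in> V" "w \<in> V" "parity v = parity w"
  shows "g v = g w"
proof -
  define sg where "sg v = (if parity v then 1 else -1 :: real)" for v
  define s where "s v = g v + T g v" for v
  define a where "a v = sg v * (g v - T g v)" for v
  have Tg: "0 \<le> T g v" "T g v \<le> 1" for v
    using markov_op_nonneg[OF op_T, of g v] markov_op_mono[OF op_T, of g "\<lambda>_. 1" v] bdd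
    by (simp_all add: markov_op_const[OF op_T])
  have "T s = s" unfolding s_def by (simp add: markov_op_add[OF op_T] inv add.commute)
  moreover have "\<bar>s v\<bar> \<le> 2" for v using bdd[of v] Tg[of v] by (simp add: s_def)
  ultimately have s: "s v = s (0, 0)" if "v \<in> V" for v
    using bounded_harmonic_const[of s 2 v] that by simp
  have "T a v = a v" if "v \<in> V" for v
  proof -
    have "T a v = T (\<lambda>u. - sg v * (g u - T g u)) v"
      by (rule avg_cong) (use that parity_nb in \<open>auto simp: set_K a_def sg_def\<close>)
    also have "\<dots> = a v"
      by (simp only: markov_op_scale[OF op_T] markov_op_diff[OF op_T] inv) (simp add: a_def algebra_simps)
    finally show ?thesis .
  qed
  moreover have "\<bar>a v\<bar> \<le> 2" for v using bdd[of v] Tg[of v] by (simp add: a_def sg_def abs_if)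
  ultimately have a: "a v = a (0, 0)" if "v \<in> V" for v
    using bounded_harmonic_const[of a 2 v] that by simp
  have "2 * g u = s u + sg u * a u" for u by (simp add: s_def a_def sg_def)
  then show ?thesis using s[of v] s[of w] a[of v] a[of w] assms(4-6)
    by (simp add: sg_def) (smt (verit))
qed

end

section \<open>Heat kernel bounds on the comb\<close>

lemma convex_bounded_imp_decreasing:
  fixes c :: "nat \<Rightarrow> real"
  assumes conv: "\<And>k. 2 * c (Suc k) \<le> c k + c (Suc (Suc k))" and bdd: "\<And>k. c k \<le> B"
  shows "c (Suc k) \<le> c k"
proof (rule ccontr)
  assume "\<not> c (Suc k) \<le> c k"
  define d where "d = c (Suc k) - c k"
  have "d > 0" using \<open>\<not> _\<close> by (simp add: d_def)
  have inc: "c (Suc (k + m)) - c (k + m) \<ge> d" for m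
  proof (induction m)
    case (Suc m) then show ?case using conv[of "k + m"] by simp
  qed (simp add: d_def)
  have "c (k + m) \<ge> c k + real m * d" for m
  proof (induction m)
    case (Suc m) then show ?case using inc[of m] by (simp add: algebra_simps)
  qed simp
  moreover obtain m where "real m * d > B - c k" using reals_Archimedean3[OF \<open>d > 0\<close>] by blast
  ultimately show False using bdd[of "k + m"] by (smt (verit))
qed

context comb
begin

subsection \<open>Squared displacement\<close>

lemma Tn_le_linear:
  assumes "\<And>u. u \<in> V \<Longrightarrow> T g u \<le> g u + c" "v \<in> V"
  shows "(T ^^ n) g v \<le> g v + real n * c"
  using assms(2)
proof (induction n arbitrary: v)
  case (Suc n)
  have "T ((T ^^ n) g) v \<le> T (\<lambda>u. g u + real n * c) v"
    by (rule avg_mono) (use Suc nb_subset in \<open>auto simp: set_K\<close>)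
  also have "\<dots> = T g v + real n * c"
    by (simp add: markov_op_add[OF op_T] markov_op_const[OF op_T])
  finally show ?case using assms(1)[OF Suc.prems] by (simp add: algebra_simps)
qed simp

text \<open>
  The squared horizontal displacement grows by at most two per step on average, so this is
  Chebyshev's inequality with the window at twice the standard deviation bound.
\<close>

lemma prob_near_start:
  assumes "v \<in> V" "n \<ge> 1"
  shows "3 / 4 \<le> (T ^^ n) (indicator {u \<in> V. (fst u - fst v)\<^sup>2 \<le> 8 * int n}) v"
proof -
  define S where "S = {u \<in> V. (fst u - fst v)\<^sup>2 \<le> 8 * int n}"
  define q where "q u = real_of_int ((fst u - fst v)\<^sup>2)" for u :: "int \<times> int"
  have "T q u \<le> q u + 2" if "u \<in> V" for u
  proof -
    obtain x y where u: "u = (x, y)" by (cases u)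
    have "lap q u \<le> 2"
      using that unfolding u by (subst lap_eq) (auto simp: q_def power2_eq_square algebra_simps)
    moreover have "lap q u / deg u \<le> 2 / deg u"
      using calculation deg_bounds[OF that] by (intro divide_right_mono) auto
    moreover have "2 / deg u \<le> 2" using deg_bounds[OF that] by (simp add: divide_le_eq)
    ultimately show ?thesis by (simp add: T_lap[OF that])
  qed
  hence q: "(T ^^ n) q v \<le> 2 * real n" using Tn_le_linear[of q 2 v n] assms(1) by (simp add: q_def)
  have "1 - 1 / (8 * real n) * q u \<le> indicator S u" if "u \<in> V" for u
  proof (cases "u \<in> S")
    case True
    have "0 \<le> q u" by (simp add: q_def)
    then show ?thesis using True by simp
  next
    case False
    hence "8 * int n < (fst u - fst v)\<^sup>2" using that by (simp add: S_def)
    hence "8 * real n < q u" unfolding q_def by (metis of_int_less_iff of_int_mult of_int_numeral of_int_of_nat_eq)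
    then show ?thesis using False assms(2) by (simp add: field_simps)
  qed
  hence "(T ^^ n) (\<lambda>u. 1 - 1 / (8 * real n) * q u) v \<le> (T ^^ n) (indicator S) v"
    by (intro Tn_mono_on_V assms(1)) auto
  moreover have "(T ^^ n) (\<lambda>u. 1 - 1 / (8 * real n) * q u) v = 1 - 1 / (8 * real n) * (T ^^ n) q v"
    by (simp only: markov_op_diff[OF op_Tn] markov_op_scale[OF op_Tn] markov_op_const[OF op_Tn])
  moreover have "1 / (8 * real n) * (T ^^ n) q v \<le> 1 / 4"
    using q assms(2) by (simp add: field_simps)
  ultimately show ?thesis by (simp add: S_def)
qed

subsection \<open>Return probabilities\<close>

definition hk :: "nat \<Rightarrow> int \<times> int \<Rightarrow> int \<times> int \<Rightarrow> real" where
  "hk n v u = (T ^^ n) (indicator {u}) v"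

lemma hk_bounds: "0 \<le> hk n v u" "hk n v u \<le> 1"
  using markov_op_nonneg[OF op_Tn, of "indicator {u}" n v]
    markov_op_mono[OF op_Tn, of "indicator {u}" "\<lambda>_. 1" n v]
  by (simp_all add: hk_def indicator_def markov_op_const[OF op_Tn])

text \<open>
  Between \<open>v\<close> and the spine the potential is the distance to \<open>v\<close>; beyond \<open>v\<close> it is zero. Both halves
  of the spine continue it with slope \<open>1/2\<close>: the unit flow that arrives from \<open>v\<close> splits evenly
  between them, and no flow enters the other teeth or the opposite half of the column of \<open>v\<close>. If \<open>v\<close>
  lies on the spine, the two flows start at \<open>v\<close> itself.
\<close>

definition pot :: "int \<times> int \<Rightarrow> int \<times> int \<Rightarrow> real" where
  "pot v u = (if fst u = fst v
     then max 0 (\<bar>real_of_int (snd v)\<bar> - max 0 (real_of_int (sgn (snd v) * snd u)))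
     else \<bar>real_of_int (snd v)\<bar> + \<bar>real_of_int (fst u - fst v)\<bar> / 2)"

lemma lap_pot:
  assumes v: "v \<in> V" and w: "w \<in> V"
  shows "lap (pot v) w = indicator {v} w"
proof -
  obtain a b x y where [simp]: "v = (a, b)" "w = (x, y)" by (cases v, cases w)
  have t1: "y > 0 \<Longrightarrow> (x, y - 1) \<in> V" "y < 0 \<Longrightarrow> (x, y + 1) \<in> V"
    using tooth_down[of x y] tooth_up[of x y] w by auto
  have t2: "b > 0 \<Longrightarrow> (a, 1) \<in> V" "b < 0 \<Longrightarrow> (a, -1) \<in> V"
    using v by (auto simp: V_iff)
  have t3: "0 \<le> y \<Longrightarrow> y < b \<Longrightarrow> (a, y + 1) \<in> V" "b < y \<Longrightarrow> y \<le> 0 \<Longrightarrow> (a, y - 1) \<in> V"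
    using v by (auto simp: V_iff)
  have L: "lap (pot v) w = (if (x, y + 1) \<in> V then pot v (x, y + 1) - pot v (x, y) else 0) +
      (if (x, y - 1) \<in> V then pot v (x, y - 1) - pot v (x, y) else 0) +
      (if y = 0 then pot v (x + 1, 0) - pot v (x, 0) + (pot v (x - 1, 0) - pot v (x, 0)) else 0)"
    using w by (simp add: lap_eq)
  show ?thesis
  proof (cases "x = a")
    case True
    have y: "y > 0 \<or> y < 0 \<or> y = 0" by linarith
    consider "b > 0" | "b < 0" | "b = 0" by linarith
    then show ?thesis
    proof cases
      case 1
      then show ?thesis unfolding L using y w t1 t2 t3 True
        by (elim disjE) (auto simp: pot_def indicator_def max_def)
    next
      case 2
      then show ?thesis unfolding L using y w t1 t2 t3 True
        by (elim disjE) (auto simp: pot_def indicator_def max_def)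
    next
      case 3
      then show ?thesis unfolding L using y w t1 t2 t3 True
        by (elim disjE) (auto simp: pot_def indicator_def max_def)
    qed
  next
    case False
    have s: "pot (a, b) (z, 0) = \<bar>real_of_int b\<bar> + \<bar>real_of_int (z - a)\<bar> / 2" for z
      by (simp add: pot_def)
    have "\<bar>real_of_int (x + 1 - a)\<bar> + \<bar>real_of_int (x - 1 - a)\<bar> = 2 * \<bar>real_of_int (x - a)\<bar>"
    proof -
      have "\<bar>x + 1 - a\<bar> + \<bar>x - 1 - a\<bar> = 2 * \<bar>x - a\<bar>" using False by arith
      from arg_cong[OF this, of real_of_int] show ?thesis by simp
    qed
    moreover have "pot (a, b) (x, z) = \<bar>real_of_int b\<bar> + \<bar>real_of_int (x - a)\<bar> / 2" for z
      using False by (simp add: pot_def)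
    ultimately show ?thesis using w False
      by (subst \<open>w = _\<close>, subst lap_eq) (auto simp: s indicator_def)
  qed
qed

lemma pot_lipschitz:
  assumes "w \<in> V" "u \<in> nb w" shows "\<bar>pot v u - pot v w\<bar> \<le> 1"
proof -
  obtain a b x y where [simp]: "v = (a, b)" "w = (x, y)" by (cases v, cases w)
  have lip: "\<bar>max 0 (c - max 0 p) - max 0 (c - max 0 q)\<bar> \<le> 1" if "\<bar>p - q\<bar> \<le> 1" for c p q :: real
    using that unfolding max_def by (smt (verit))
  have vert: "\<bar>pot v (x, z) - pot v (x, y)\<bar> \<le> 1" if "\<bar>z - y\<bar> \<le> 1" for z
  proof (cases "x = a")
    case True
    have "\<bar>real_of_int (sgn b * z) - real_of_int (sgn b * y)\<bar> \<le> 1"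
      using that by (simp add: sgn_if) linarith
    then show ?thesis using lip True by (simp add: pot_def)
  qed (simp add: pot_def)
  have hor: "pot (a, b) (z, 0) = \<bar>real_of_int b\<bar> + \<bar>real_of_int (z - a)\<bar> / 2" for z
    by (simp add: pot_def)
  have half: "\<bar>p - q\<bar> = 1 \<Longrightarrow> \<bar>\<bar>p\<bar> / 2 - \<bar>q\<bar> / 2\<bar> \<le> 1" for p q :: real
    using abs_triangle_ineq3[of p q] by (simp add: abs_if split: if_splits)
  have hor1: "\<bar>pot (a, b) (x + 1, 0) - pot (a, b) (x, 0)\<bar> \<le> 1"
    "\<bar>pot (a, b) (x - 1, 0) - pot (a, b) (x, 0)\<bar> \<le> 1"
    using half[of "real_of_int (x + 1 - a)" "real_of_int (x - a)"]
      half[of "real_of_int (x - 1 - a)" "real_of_int (x - a)"] by (simp_all add: hor)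
  show ?thesis
  proof (cases "fst u = x")
    case True
    then show ?thesis using assms vert[of "snd u"] by (cases u) (auto simp: nb_eq split: if_splits)
  next
    case False
    then show ?thesis using assms by (cases u) (use hor1 in \<open>auto simp: nb_eq split: if_splits\<close>)
  qed
qed

lemma pot_start: "pot v v = 0"
  by (auto simp: pot_def sgn_if)

lemma T_pot: "v \<in> V \<Longrightarrow> w \<in> V \<Longrightarrow> T (pot v) w = pot v w + indicator {v} w / deg v"
  by (simp add: T_lap lap_pot indicator_def)

text \<open>
  The cross term in the increment of the square vanishes: the potential is zero at \<open>v\<close> and harmonic
  elsewhere. What remains is the mean squared increment.
\<close>

lemma T_pot_square:
  assumes "v \<in> V" "w \<in> V" shows "T (\<lambda>u. (pot v u)\<^sup>2) w \<le> (pot v w)\<^sup>2 + 1"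
proof -
  have "lap (\<lambda>u. (pot v u)\<^sup>2) w
      = (\<Sum>u\<in>nb w. (pot v u - pot v w)\<^sup>2 + 2 * pot v w * (pot v u - pot v w))"
    unfolding lap_def by (intro sum.cong) (auto simp: power2_eq_square algebra_simps)
  also have "\<dots> = (\<Sum>u\<in>nb w. (pot v u - pot v w)\<^sup>2) + 2 * pot v w * lap (pot v) w"
    by (simp add: sum.distrib sum_distrib_left lap_def)
  also have "2 * pot v w * lap (pot v) w = 0"
    using assms by (auto simp: lap_pot indicator_def pot_start)
  also have "(\<Sum>u\<in>nb w. (pot v u - pot v w)\<^sup>2) + 0 = (\<Sum>u\<in>nb w. (pot v u - pot v w)\<^sup>2)" by simp
  also have "(\<Sum>u\<in>nb w. (pot v u - pot v w)\<^sup>2) \<le> (\<Sum>u\<in>nb w. 1)"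
    using pot_lipschitz[OF assms(2)] by (intro sum_mono) (auto simp: abs_square_le_1)
  finally have "lap (\<lambda>u. (pot v u)\<^sup>2) w \<le> deg w" by (simp add: deg_def)
  then show ?thesis using deg_bounds[OF assms(2)] by (simp add: T_lap[OF assms(2)] divide_le_eq)
qed

text \<open>
  The mean of the potential along the walk increases by \<open>1 / deg v\<close> at each expected visit to \<open>v\<close>,
  while its mean square after \<open>n\<close> steps is at most \<open>n\<close>.
\<close>

lemma green_bound:
  assumes "v \<in> V" shows "(\<Sum>k<n. hk k v v) \<le> 4 * sqrt n"
proof (cases "n = 0")
  case False
  have id: "(T ^^ k) (pot v) v = (\<Sum>i<k. hk i v v) / deg v" for k
  proof (induction k)
    case (Suc k)
    have eq: "(T ^^ k) (T (pot v)) v = (T ^^ k) (\<lambda>w. pot v w + 1 / deg v * indicator {v} w) v"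
      by (intro antisym; intro Tn_mono_on_V assms) (simp_all add: T_pot assms)
    also have "\<dots> = (T ^^ k) (pot v) v + 1 / deg v * hk k v v"
      by (simp only: markov_op_add[OF op_Tn] markov_op_scale[OF op_Tn] hk_def)
    finally show ?case using Suc
      by (simp add: funpow_Suc_right add_divide_distrib del: funpow.simps)
  qed (simp add: pot_start)
  have sq: "(T ^^ n) (\<lambda>u. (pot v u)\<^sup>2) v \<le> n"
    using Tn_le_linear[of "\<lambda>u. (pot v u)\<^sup>2" 1 v n] T_pot_square[OF assms] assms by (simp add: pot_start)
  \<comment> \<open>Jensen's inequality in linear form: the tangent to the square at \<open>sqrt n\<close>\<close>
  have "pot v u \<le> 1 / (2 * sqrt n) * (pot v u)\<^sup>2 + sqrt n / 2" for u
  proof -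
    have "0 \<le> (pot v u - sqrt n)\<^sup>2" by simp
    then show ?thesis using False by (simp add: field_simps power2_eq_square)
  qed
  hence "(T ^^ n) (pot v) v \<le> (T ^^ n) (\<lambda>u. 1 / (2 * sqrt n) * (pot v u)\<^sup>2 + sqrt n / 2) v"
    by (rule markov_op_mono[OF op_Tn])
  also have "\<dots> = 1 / (2 * sqrt n) * (T ^^ n) (\<lambda>u. (pot v u)\<^sup>2) v + sqrt n / 2"
    by (simp only: markov_op_add[OF op_Tn] markov_op_scale[OF op_Tn] markov_op_const[OF op_Tn])
  also have "\<dots> \<le> 1 / (2 * sqrt n) * n + sqrt n / 2"
    using sq by (intro add_mono mult_left_mono) auto
  also have "\<dots> = sqrt n" using False by (simp add: field_simps)
  finally have "(\<Sum>i<n. hk i v v) \<le> deg v * sqrt n"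
    using deg_bounds[OF assms] by (simp add: id field_simps)
  also have "\<dots> \<le> 4 * sqrt n" using deg_bounds[OF assms] by (intro mult_right_mono) auto
  finally show ?thesis .
qed simp

subsection \<open>Reversibility\<close>

text \<open>
  The inner product is weighted by the degree, the reversible measure. Restricting to functions that
  vanish outside a finite set keeps all sums finite.
\<close>

lemma T_self_adjoint:
  assumes B: "finite B" "B \<subseteq> V" and f: "\<And>u. u \<notin> B \<Longrightarrow> f u = 0" and g: "\<And>u. u \<notin> B \<Longrightarrow> g u = 0"
  shows "(\<Sum>u\<in>B. deg u * T f u * g u) = (\<Sum>u\<in>B. deg u * f u * T g u)"
proof -
  have dT: "deg u * T h u = (\<Sum>w\<in>B. if w \<in> nb u then h w else 0)"
    if "u \<in> B" "\<And>u. u \<notin> B \<Longrightarrow> h u = 0" for h u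
  proof -
    have u: "u \<in> V" using that B by auto
    have "deg u * T h u = (\<Sum>w\<in>nb u. h w)" using deg_bounds[OF u] by (simp add: T_V[OF u])
    also have "\<dots> = (\<Sum>w\<in>B \<inter> nb u. h w)"
      by (rule sum.mono_neutral_right) (use finite_nb[OF u] that in auto)
    also have "\<dots> = (\<Sum>w\<in>B. if w \<in> nb u then h w else 0)"
      using B by (simp add: sum.inter_restrict)
    finally show ?thesis .
  qed
  have "(\<Sum>u\<in>B. deg u * T f u * g u) = (\<Sum>u\<in>B. \<Sum>w\<in>B. if w \<in> nb u then f w * g u else 0)"
    by (intro sum.cong refl) (simp add: dT[OF _ f] sum_distrib_right if_distrib[of "\<lambda>x. x * _"] cong: if_cong)
  also have "\<dots> = (\<Sum>w\<in>B. \<Sum>u\<in>B. if u \<in> nb w then f w * g u else 0)"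
    by (subst sum.swap) (simp add: nb_sym)
  also have "\<dots> = (\<Sum>u\<in>B. deg u * f u * T g u)"
  proof (intro sum.cong refl)
    fix u assume "u \<in> B"
    have "deg u * f u * T g u = f u * (deg u * T g u)" by (simp add: mult_ac)
    also have "\<dots> = (\<Sum>w\<in>B. if w \<in> nb u then f u * g w else 0)"
      by (simp add: dT[OF \<open>u \<in> B\<close> g] sum_distrib_left if_distrib[of "\<lambda>x. _ * x"] cong: if_cong)
    finally show "(\<Sum>w\<in>B. if w \<in> nb u then f u * g w else 0) = deg u * f u * T g u" by simp
  qed
  finally show ?thesis .
qed

definition box :: "int \<Rightarrow> nat \<Rightarrow> (int \<times> int) set" where
  "box a r = {u \<in> V. \<bar>fst u - a\<bar> \<le> int r}"

lemma finite_box: "finite (box a r)"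
proof -
  have "box a r \<subseteq> (SIGMA x:{a - int r..a + int r}. {- \<lfloor>F x\<rfloor>..\<lfloor>F x\<rfloor>})"
    by (auto simp: box_def V_iff le_floor_iff) linarith
  then show ?thesis by (rule finite_subset) auto
qed

lemma box_subset: "box a r \<subseteq> V" by (auto simp: box_def)

lemma hk_outside_box:
  assumes "v \<in> V" "w \<notin> box (fst v) n" shows "hk n w v = 0"
  using assms(2)
proof (induction n arbitrary: w)
  case 0 then show ?case using assms(1) by (auto simp: hk_def box_def indicator_def)
next
  case (Suc n)
  have "hk (Suc n) w v = T (\<lambda>u. hk n u v) w" by (simp add: hk_def[abs_def])
  also have "\<dots> = T (\<lambda>_. 0) w"
  proof (rule avg_cong)
    fix u assume u: "u \<in> set_pmf (K w)"
    show "hk n u v = 0"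
    proof (rule Suc.IH, rule notI)
      assume "u \<in> box (fst v) n"
      moreover from this u have "w \<in> V" using nb_subset[of u w] nb_sym by (auto simp: set_K box_def split: if_splits)
      moreover from this u have "\<bar>fst w - fst u\<bar> \<le> 1" by (cases w) (auto simp: set_K nb_eq split: if_splits)
      ultimately show False using Suc.prems by (auto simp: box_def)
    qed
  qed
  finally show ?case by (simp add: markov_op_const[OF op_T])
qed

text \<open>
  Moving all steps to one factor by self-adjointness leaves the transition probability of \<open>j + k\<close>
  steps. The set \<open>B\<close> has to contain everything that can be reached within \<open>R\<close> steps.
\<close>

lemma hk_inner:
  assumes v: "v \<in> V" and u: "u \<in> V" and B: "finite B" "B \<subseteq> V"
    and R: "box (fst v) R \<subseteq> B" "box (fst u) R \<subseteq> B" and "j + k \<le> R"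
  shows "(\<Sum>w\<in>B. deg w * hk j w v * hk k w u) = deg u * hk (j + k) u v"
  using \<open>j + k \<le> R\<close>
proof (induction k arbitrary: j)
  case 0
  have "u \<in> B" using u R by (auto simp: box_def)
  then show ?case using B
    by (simp add: hk_def[of 0] indicator_def[abs_def] if_distrib[of "\<lambda>x. _ * x"] cong: if_cong)
next
  case (Suc k)
  have sub: "box a i \<subseteq> box a R" if "i \<le> R" for a i using that by (auto simp: box_def)
  have zv: "hk i w v = 0" if "w \<notin> B" "i \<le> R" for i w
    using hk_outside_box[OF v, of w i] sub[OF that(2)] R that by blast
  have zu: "hk i w u = 0" if "w \<notin> B" "i \<le> R" for i w
    using hk_outside_box[OF u, of w i] sub[OF that(2)] R that by blast
  have "(\<Sum>w\<in>B. deg w * hk j w v * hk (Suc k) w u) = (\<Sum>w\<in>B. deg w * hk j w v * T (\<lambda>x. hk k x u) w)"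
    by (simp add: hk_def[abs_def])
  also have "\<dots> = (\<Sum>w\<in>B. deg w * T (\<lambda>x. hk j x v) w * hk k w u)"
    by (rule T_self_adjoint[symmetric, OF B]) (use zv zu Suc.prems in auto)
  also have "\<dots> = (\<Sum>w\<in>B. deg w * hk (Suc j) w v * hk k w u)"
    by (simp add: hk_def[abs_def])
  also have "\<dots> = deg u * hk (j + Suc k) u v" using Suc.IH[of "Suc j"] Suc.prems by simp
  finally show ?case .
qed

text \<open>
  Up to the factor \<open>deg v\<close>, the second difference of the even return probabilities is the squared
  norm of the difference between the kernels after \<open>k\<close> and \<open>k + 2\<close> steps.
\<close>

lemma hk_convex:
  assumes v: "v \<in> V"
  shows "2 * hk (2 * Suc k) v v \<le> hk (2 * k) v v + hk (2 * Suc (Suc k)) v v"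
proof -
  define R where "R = 2 * k + 4"
  let ?B = "box (fst v) R"
  note I = hk_inner[OF v v finite_box box_subset order_refl order_refl, of _ _ R]
  have "0 \<le> (\<Sum>w\<in>?B. deg w * (hk k w v - hk (k + 2) w v)\<^sup>2)"
    by (intro sum_nonneg) (auto simp: deg_def)
  also have "\<dots> = (\<Sum>w\<in>?B. deg w * hk k w v * hk k w v) - 2 * (\<Sum>w\<in>?B. deg w * hk k w v * hk (k + 2) w v)
      + (\<Sum>w\<in>?B. deg w * hk (k + 2) w v * hk (k + 2) w v)"
    by (simp add: sum_subtractf[symmetric] sum.distrib[symmetric] sum_distrib_left power2_eq_square algebra_simps)
  also have "\<dots> = deg v * (hk (k + k) v v - 2 * hk (k + (k + 2)) v v + hk (k + 2 + (k + 2)) v v)"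
    by (subst (1 2 3) I) (auto simp: R_def algebra_simps)
  finally have "0 \<le> hk (k + k) v v - 2 * hk (k + (k + 2)) v v + hk (k + 2 + (k + 2)) v v"
    using deg_bounds[OF v] by (simp add: zero_le_mult_iff)
  moreover have "k + k = 2 * k" "k + (k + 2) = 2 * Suc k" "k + 2 + (k + 2) = 2 * Suc (Suc k)" by auto
  ultimately show ?thesis by simp
qed

text \<open>
  The even return probabilities decrease, so \<open>k\<close> times the last one is bounded by the expected number
  of returns.
\<close>

lemma return_prob_bound:
  assumes v: "v \<in> V" and "k \<ge> 1" shows "hk (2 * k) v v \<le> 8 / sqrt k"
proof -
  have dec: "hk (2 * Suc i) v v \<le> hk (2 * i) v v" for i
    using convex_bounded_imp_decreasing[of "\<lambda>i. hk (2 * i) v v" 1] hk_convex[OF v] hk_bounds by blast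
  have mono: "i \<le> k \<Longrightarrow> hk (2 * k) v v \<le> hk (2 * i) v v" for i
    using lift_Suc_antimono_le[of "\<lambda>i. hk (2 * i) v v", OF dec] .
  have "real k * hk (2 * k) v v \<le> (\<Sum>i<k. hk (2 * i) v v)"
    using sum_mono[of "{..<k}" "\<lambda>_. hk (2 * k) v v" "\<lambda>i. hk (2 * i) v v"] mono by simp
  also have "\<dots> = (\<Sum>i\<in>(\<lambda>i. 2 * i) ` {..<k}. hk i v v)"
    by (subst sum.reindex) (auto simp: inj_on_def)
  also have "\<dots> \<le> (\<Sum>i<2 * k. hk i v v)"
    by (rule sum_mono2) (auto simp: hk_bounds)
  also have "\<dots> \<le> 4 * sqrt (2 * k)" using green_bound[OF v, of "2 * k"] by simp
  also have "\<dots> \<le> 4 * sqrt (4 * k)" by simp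
  also have "\<dots> = 8 * sqrt k" by (simp add: real_sqrt_mult)
  finally have "sqrt k * (sqrt k * hk (2 * k) v v) \<le> sqrt k * 8"
    by (simp add: mult.assoc[symmetric] mult.commute)
  hence "sqrt k * hk (2 * k) v v \<le> 8" using \<open>k \<ge> 1\<close> by (simp add: mult_le_cancel_left)
  then show ?thesis using \<open>k \<ge> 1\<close> by (simp add: field_simps)
qed

text \<open>
  By Cauchy--Schwarz for the weighted inner product, the off-diagonal kernel is controlled by the
  return probabilities at both ends. The arithmetic mean replaces the geometric one here.
\<close>

lemma hk_even_bound:
  assumes v: "v \<in> V" and u: "u \<in> V" and "k \<ge> 1" shows "hk (2 * k) u v \<le> 32 / sqrt k"
proof -
  define B where "B = box (fst v) (2 * k) \<union> box (fst u) (2 * k)"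
  have B: "finite B" "B \<subseteq> V" "box (fst v) (2 * k) \<subseteq> B" "box (fst u) (2 * k) \<subseteq> B"
    using finite_box box_subset by (auto simp: B_def)
  have "hk (2 * k) u v \<le> deg u * hk (2 * k) u v"
    using mult_right_mono[OF deg_bounds(1)[OF u] hk_bounds(1)] by simp
  also have "\<dots> = (\<Sum>w\<in>B. deg w * hk k w v * hk k w u)"
    using hk_inner[OF v u B, of k k] by (simp add: mult_2)
  also have "\<dots> \<le> (\<Sum>w\<in>B. (deg w * hk k w v * hk k w v) / 2 + (deg w * hk k w u * hk k w u) / 2)"
  proof (rule sum_mono)
    fix w
    have "0 \<le> deg w * (hk k w v - hk k w u)\<^sup>2" by (simp add: deg_def)
    then show "deg w * hk k w v * hk k w u \<le> (deg w * hk k w v * hk k w v) / 2 + (deg w * hk k w u * hk k w u) / 2"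
      by (simp add: power2_eq_square algebra_simps)
  qed
  also have "\<dots> = deg v * hk (2 * k) v v / 2 + deg u * hk (2 * k) u u / 2"
    using hk_inner[OF v v B(1,2,3,3), of k k] hk_inner[OF u u B(1,2,4,4), of k k]
    by (simp add: mult_2 sum.distrib sum_divide_distrib[symmetric])
  also have "\<dots> \<le> 4 * (8 / sqrt k) / 2 + 4 * (8 / sqrt k) / 2"
    using deg_bounds[OF v] deg_bounds[OF u] return_prob_bound[OF v] return_prob_bound[OF u] \<open>k \<ge> 1\<close> hk_bounds
    by (intro add_mono divide_right_mono mult_mono) auto
  finally show ?thesis by simp
qed

lemma heat_kernel_bound:
  assumes v: "v \<in> V" and "n \<ge> 1" shows "hk n v u \<le> 64 / sqrt n"
proof (cases "u \<in> V")
  case False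
  have "(T ^^ n) (indicator {u}) v \<le> (T ^^ n) (\<lambda>_. 0) v"
    by (rule Tn_mono_on_V[OF _ v]) (use False in \<open>auto simp: indicator_def\<close>)
  then show ?thesis by (simp add: hk_def markov_op_const[OF op_Tn] order_trans)
next
  case u: True
  define k where "k = n div 2"
  show ?thesis
  proof (cases "n = 1")
    case True then show ?thesis using hk_bounds(2)[of n v u] by simp
  next
    case False
    hence k: "k \<ge> 1" "n \<le> 3 * k" using \<open>n \<ge> 1\<close> unfolding k_def by presburger+
    have "hk n v u \<le> 32 / sqrt k"
    proof (cases "even n")
      case True
      then show ?thesis using hk_even_bound[OF u v k(1)] by (simp add: k_def)
    next
      case False
      hence n: "n = Suc (2 * k)" by (simp add: k_def)
      have "hk n v u = T (\<lambda>w. hk (2 * k) w u) v" by (simp add: n hk_def[abs_def])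
      also have "\<dots> \<le> T (\<lambda>_. 32 / sqrt k) v"
        by (rule avg_mono) (use hk_even_bound[OF u _ k(1)] v nb_subset[OF v] in \<open>auto simp: set_K\<close>)
      finally show ?thesis by (simp add: markov_op_const[OF op_T])
    qed
    also have "32 / sqrt k \<le> 64 / sqrt n"
    proof -
      have "sqrt n \<le> sqrt (4 * k)" using k(2) by simp
      also have "\<dots> = 2 * sqrt k" by (simp add: real_sqrt_mult)
      finally have "sqrt n \<le> 2 * sqrt k" .
      then show ?thesis using k(1) \<open>n \<ge> 1\<close> by (simp add: field_simps)
    qed
    finally show ?thesis .
  qed
qed

end

section \<open>Triple collisions on the comb\<close>

text \<open>
  This bounds the number of comb vertices in the columns within distance \<open>3 \<surd>n\<close> of \<open>a\<close>, which
  contain the window of the displacement estimate since \<open>8 \<le> 9\<close>.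
\<close>

definition window_volume :: "(int \<Rightarrow> real) \<Rightarrow> int \<Rightarrow> nat \<Rightarrow> real" where
  "window_volume F a n = (\<Sum>x\<in>{a - \<lfloor>3 * sqrt n\<rfloor>..a + \<lfloor>3 * sqrt n\<rfloor>}. 2 * F x + 1)"

text \<open>
  Along a subsequence, the averages of \<open>window_volume F a k / sqrt k\<close> with weights \<open>1 / k\<close> are
  bounded. The logarithmic weights are those with which collision probabilities add up.
\<close>

definition moderate_growth :: "(int \<Rightarrow> real) \<Rightarrow> bool" where
  "moderate_growth F \<longleftrightarrow> (\<forall>a. \<exists>t>0. \<exists>\<^sub>F n in sequentially.
     (\<Sum>k=1..n. window_volume F a k / (real k * sqrt k)) \<le> t * harm n)"

context comb
begin

definition K3 :: "(int \<times> int) \<times> (int \<times> int) \<times> (int \<times> int) \<Rightarrow> _ pmf" where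
  "K3 = pair_kernel K (pair_kernel K K)"

text \<open>
  Collisions are counted on the comb only. Outside the comb the kernel never moves, so the
  collision estimates would fail there.
\<close>

definition diag :: "((int \<times> int) \<times> (int \<times> int) \<times> (int \<times> int)) set" where
  "diag = {(x, y, z). x \<in> V \<and> y = x \<and> z = x}"

lemma finite_K3: "finite (set_pmf (K3 s))"
  unfolding K3_def by (intro finite_pair_kernel finite_K)

text \<open>
  Conditionally on the position \<open>x\<close> of the first walker at time \<open>n\<close>, the two others
  are at \<open>x\<close> independently of each other.
\<close>

lemma collision_prob:
  "(avg K3 ^^ n) (indicator diag) (v, v, v) = (T ^^ n) (\<lambda>x. indicator V x * (hk n v x)\<^sup>2) v"
proof -
  have d: "indicator diag (x, y, z) = (indicator V x * indicator {x} y) * indicat_real {x} z" for x y z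
    by (auto simp: diag_def indicator_def)
  have "(T ^^ n) (\<lambda>y. (T ^^ n) (\<lambda>z. indicator diag (x, y, z)) v) v = indicator V x * (hk n v x)\<^sup>2" for x
  proof -
    have "(T ^^ n) (\<lambda>z. indicator diag (x, y, z)) v = (hk n v x * indicator V x) * indicator {x} y" for y
      by (simp only: d markov_op_scale[OF op_Tn]) (simp add: hk_def)
    hence "(T ^^ n) (\<lambda>y. (T ^^ n) (\<lambda>z. indicator diag (x, y, z)) v) v
        = (T ^^ n) (\<lambda>y. (hk n v x * indicator V x) * indicator {x} y) v"
      by (simp only:)
    also have "\<dots> = hk n v x * indicator V x * hk n v x"
      by (simp only: markov_op_scale[OF op_Tn] hk_def)
    finally show ?thesis by (simp add: power2_eq_square mult_ac)
  qed
  then show ?thesis unfolding K3_def avg_pair_kernel_funpow by simp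
qed

lemma collision_prob_upper:
  assumes "s \<in> diag" "n \<ge> 1" shows "(avg K3 ^^ n) (indicator diag) s \<le> 4096 / real n"
proof -
  obtain v where s: "s = (v, v, v)" and v: "v \<in> V" using assms(1) by (auto simp: diag_def)
  have "indicator V x * (hk n v x)\<^sup>2 \<le> 4096 / real n" for x
  proof -
    have "(hk n v x)\<^sup>2 \<le> (64 / sqrt n)\<^sup>2"
      by (intro power_mono heat_kernel_bound v assms hk_bounds)
    also have "\<dots> = 4096 / real n" by (simp add: power_divide)
    finally show ?thesis by (auto simp: indicator_def)
  qed
  hence "(T ^^ n) (\<lambda>x. indicator V x * (hk n v x)\<^sup>2) v \<le> (T ^^ n) (\<lambda>_. 4096 / real n) v"
    by (rule markov_op_mono[OF op_Tn])
  then show ?thesis by (simp add: s collision_prob markov_op_const[OF op_Tn])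
qed

lemma window:
  fixes a n defines "S \<equiv> {u \<in> V. (fst u - a)\<^sup>2 \<le> 8 * int n}"
  shows "finite S" "real (card S) \<le> window_volume F a n"
proof -
  define r where "r = \<lfloor>3 * sqrt n\<rfloor>"
  have "\<bar>fst u - a\<bar> \<le> r" if "u \<in> S" for u
  proof -
    have "(real_of_int (fst u - a))\<^sup>2 \<le> 9 * real n"
    proof -
      have "real_of_int ((fst u - a)\<^sup>2) \<le> real_of_int (8 * int n)" using that by (simp only: S_def of_int_le_iff mem_Collect_eq)
      then show ?thesis by simp
    qed
    hence "\<bar>real_of_int (fst u - a)\<bar> \<le> sqrt (9 * real n)" by (metis real_sqrt_abs real_sqrt_le_iff)
    hence "real_of_int \<bar>fst u - a\<bar> \<le> 3 * sqrt n" by (simp add: real_sqrt_mult)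
    then show ?thesis by (simp add: r_def le_floor_iff)
  qed
  note near = this
  have sub: "S \<subseteq> (SIGMA x:{a - r..a + r}. {- \<lfloor>F x\<rfloor>..\<lfloor>F x\<rfloor>})"
  proof
    fix u assume u: "u \<in> S"
    obtain x y where xy: "u = (x, y)" by (cases u)
    have "(x, y) \<in> V" using u by (simp add: S_def xy)
    hence "- y \<le> \<lfloor>F x\<rfloor>" "y \<le> \<lfloor>F x\<rfloor>" by (auto simp: V_iff le_floor_iff)
    moreover have "\<bar>x - a\<bar> \<le> r" using near[OF u] by (simp add: xy)
    ultimately show "u \<in> (SIGMA x:{a - r..a + r}. {- \<lfloor>F x\<rfloor>..\<lfloor>F x\<rfloor>})" by (auto simp: xy)
  qed
  then show "finite S" by (rule finite_subset) auto
  have "real (card S) \<le> real (card (SIGMA x:{a - r..a + r}. {- \<lfloor>F x\<rfloor>..\<lfloor>F x\<rfloor>}))"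
    by (intro of_nat_mono card_mono sub) auto
  also have "\<dots> = (\<Sum>x\<in>{a - r..a + r}. real (card {- \<lfloor>F x\<rfloor>..\<lfloor>F x\<rfloor>}))" by simp
  also have "\<dots> \<le> (\<Sum>x\<in>{a - r..a + r}. 2 * F x + 1)"
  proof (rule sum_mono)
    fix x
    have "0 \<le> \<lfloor>F x\<rfloor>" using F_nonneg by simp
    moreover have "real_of_int \<lfloor>F x\<rfloor> \<le> F x" by simp
    ultimately show "real (card {- \<lfloor>F x\<rfloor>..\<lfloor>F x\<rfloor>}) \<le> 2 * F x + 1" by simp
  qed
  finally show "real (card S) \<le> window_volume F a n" by (simp add: window_volume_def r_def)
qed

text \<open>
  On the window \<open>S\<close> the tangent inequality \<open>p^3 \<ge> 3 s\<^sup>2 p - 2 s^3\<close> replaces the power mean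
  inequality. It is used at \<open>s = \<sigma> / \<surd>n\<close>, the size of a uniform density on a window of volume of order
  \<open>\<surd>n\<close>. The bound is linear in the volume, so only averages of volumes over time matter later on.
\<close>

lemma collision_prob_lower:
  assumes v: "v \<in> V" and "n \<ge> 1" and "\<sigma> > 0"
  shows "\<sigma>\<^sup>2 * (9 / 4 * (1 / real n) - 2 * \<sigma> * (window_volume F (fst v) n / (real n * sqrt n)))
    \<le> (avg K3 ^^ n) (indicator diag) (v, v, v)"
proof -
  define S where "S = {u \<in> V. (fst u - fst v)\<^sup>2 \<le> 8 * int n}"
  note S = window[of "fst v" n, folded S_def]
  define s where "s = \<sigma> / sqrt n"
  have s: "s > 0" using assms by (simp add: s_def)
  have cube: "3 * s\<^sup>2 * p - 2 * s ^ 3 \<le> p\<^sup>2 * p" if "0 \<le> p" for p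
  proof -
    have "0 \<le> (p - s)\<^sup>2 * (p + 2 * s)" using that s by simp
    then show ?thesis by (simp add: power2_eq_square power3_eq_cube algebra_simps)
  qed
  have indS: "(\<Sum>u\<in>S. c u * indicator {u} w) = indicator S w * c w" for w and c :: "_ \<Rightarrow> real"
    using S(1) by (simp add: indicator_def[abs_def] if_distrib[of "\<lambda>x. _ * x"] cong: if_cong)
  have "3 * s\<^sup>2 * (3 / 4) - 2 * s ^ 3 * window_volume F (fst v) n \<le> 3 * s\<^sup>2 * (\<Sum>u\<in>S. hk n v u) - 2 * s ^ 3 * real (card S)"
  proof (intro diff_mono mult_left_mono)
    have "(\<Sum>u\<in>S. hk n v u) = (T ^^ n) (\<lambda>w. \<Sum>u\<in>S. 1 * indicator {u} w) v"
      by (simp add: markov_op_sum[OF op_Tn] hk_def)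
    also have "\<dots> = (T ^^ n) (indicator S) v" by (subst indS) simp
    finally show "3 / 4 \<le> (\<Sum>u\<in>S. hk n v u)" using prob_near_start[OF v \<open>n \<ge> 1\<close>] by (simp add: S_def)
  qed (use s S(2) in auto)
  also have "\<dots> = (\<Sum>u\<in>S. 3 * s\<^sup>2 * hk n v u - 2 * s ^ 3)"
    by (simp add: sum_subtractf sum_distrib_left)
  also have "\<dots> \<le> (\<Sum>u\<in>S. (hk n v u)\<^sup>2 * hk n v u)"
    by (intro sum_mono cube hk_bounds)
  also have "\<dots> = (T ^^ n) (\<lambda>w. \<Sum>u\<in>S. (hk n v u)\<^sup>2 * indicator {u} w) v"
    by (simp only: markov_op_sum[OF op_Tn] markov_op_scale[OF op_Tn] hk_def)
  also have "\<dots> \<le> (T ^^ n) (\<lambda>x. indicator V x * (hk n v x)\<^sup>2) v"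
  proof (rule markov_op_mono[OF op_Tn])
    fix w
    show "(\<Sum>u\<in>S. (hk n v u)\<^sup>2 * indicator {u} w) \<le> indicator V w * (hk n v w)\<^sup>2"
      unfolding indS by (auto simp: indicator_def S_def)
  qed
  also have "\<dots> = (avg K3 ^^ n) (indicator diag) (v, v, v)" by (simp add: collision_prob)
  finally have *: "3 * s\<^sup>2 * (3 / 4) - 2 * s ^ 3 * window_volume F (fst v) n \<le> (avg K3 ^^ n) (indicator diag) (v, v, v)" .
  have "s\<^sup>2 = \<sigma>\<^sup>2 / real n" by (simp add: s_def power_divide)
  moreover have "s ^ 3 = \<sigma> ^ 3 / (real n * sqrt n)"
    by (simp add: s_def power_divide power3_eq_cube)
  ultimately show ?thesis using * by (simp add: algebra_simps power2_eq_square power3_eq_cube)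
qed

text \<open>
  The choice \<open>\<sigma> = 1 / (2 t)\<close> lets the volume term cancel at most \<open>1\<close> of the factor \<open>9/4\<close>.
\<close>

lemma collision_sum_lower:
  assumes v: "v \<in> V" and "t > 0"
    and N: "(\<Sum>n=1..N. window_volume F (fst v) n / (real n * sqrt n)) \<le> t * harm N"
  shows "1 / (4 * t\<^sup>2) * harm N \<le> (\<Sum>n=1..N. (avg K3 ^^ n) (indicator diag) (v, v, v))"
proof -
  define \<sigma> where "\<sigma> = 1 / (2 * t)"
  have \<sigma>: "\<sigma> > 0" "2 * \<sigma> * t = 1" using \<open>t > 0\<close> by (auto simp: \<sigma>_def)
  have h: "0 \<le> (harm N :: real)" by (rule harm_nonneg)
  have "2 * \<sigma> * (\<Sum>n=1..N. window_volume F (fst v) n / (real n * sqrt n)) \<le> 2 * \<sigma> * (t * harm N)"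
    using N \<sigma> by (intro mult_left_mono) auto
  also have "\<dots> = harm N" using \<sigma>(2) by (simp add: mult.assoc[symmetric])
  finally have "\<sigma>\<^sup>2 * harm N \<le> \<sigma>\<^sup>2 * (9 / 4 * harm N - 2 * \<sigma> * (\<Sum>n=1..N. window_volume F (fst v) n / (real n * sqrt n)))"
    using h by (intro mult_left_mono) auto
  also have "\<dots> = (\<Sum>n=1..N. \<sigma>\<^sup>2 * (9 / 4 * (1 / real n) - 2 * \<sigma> * (window_volume F (fst v) n / (real n * sqrt n))))"
    by (simp only: sum_distrib_left[symmetric] sum_subtractf harm_def inverse_eq_divide)
  also have "\<dots> \<le> (\<Sum>n=1..N. (avg K3 ^^ n) (indicator diag) (v, v, v))"
    by (intro sum_mono collision_prob_lower v \<sigma>) auto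
  finally show ?thesis by (simp add: \<sigma>_def power_divide)
qed

subsection \<open>The zero-one law\<close>

definition same_parity :: "((int \<times> int) \<times> (int \<times> int) \<times> (int \<times> int)) set" where
  "same_parity = {(x, y, z). x \<in> V \<and> y \<in> V \<and> z \<in> V \<and> parity y = parity x \<and> parity z = parity x}"

lemma same_parity_step: "s \<in> same_parity \<Longrightarrow> t \<in> set_pmf (K3 s) \<Longrightarrow> t \<in> same_parity"
proof -
  assume s: "s \<in> same_parity" and t: "t \<in> set_pmf (K3 s)"
  obtain x y z x' y' z' where [simp]: "s = (x, y, z)" "t = (x', y', z')" by (cases s, cases t)
  have V: "x \<in> V" "y \<in> V" "z \<in> V" using s by (auto simp: same_parity_def)
  have n: "x' \<in> nb x" "y' \<in> nb y" "z' \<in> nb z"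
    using t V by (auto simp: K3_def pair_kernel_def set_K)
  show ?thesis
    using s V nb_subset[OF V(1) n(1)] nb_subset[OF V(2) n(2)] nb_subset[OF V(3) n(3)]
      parity_nb[OF V(1) n(1)] parity_nb[OF V(2) n(2)] parity_nb[OF V(3) n(3)]
    by (auto simp: same_parity_def)
qed

text \<open>
  The coordinates can be replaced one after the other by any vertex of the same parity. The
  values on the two parity classes agree because one step of the joint walk leads from one
  class to the other.
\<close>

lemma harmonic_const_same_parity:
  assumes harm: "avg K3 g = g" and bdd: "\<And>s. 0 \<le> g s" "\<And>s. g s \<le> 1"
    and v: "v \<in> V" and s: "s \<in> same_parity"
  shows "g s = g (v, v, v)"
proof -
  have fin2: "finite (set_pmf (pair_kernel K K s))" for s by (intro finite_pair_kernel finite_K)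
  have inv: "avg (pair_kernel K (pair_kernel K K)) (avg (pair_kernel K (pair_kernel K K)) g) = g"
    using harm by (simp add: K3_def)
  have x: "T (T (\<lambda>x. g (x, t))) = (\<lambda>x. g (x, t))" for t
    by (rule two_step_invariant_coordinates(1)[of K "pair_kernel K K" "1 / 4" g])
      (use finite_K fin2 T_lazy inv bdd in auto)
  have yz: "avg (pair_kernel K K) (avg (pair_kernel K K) (\<lambda>t. g (x, t))) = (\<lambda>t. g (x, t))" for x
    by (rule two_step_invariant_coordinates(2)[of K "pair_kernel K K" "1 / 4" g])
      (use finite_K fin2 T_lazy inv bdd in auto)
  have y: "T (T (\<lambda>y. g (x, y, z))) = (\<lambda>y. g (x, y, z))" for x z
    by (rule two_step_invariant_coordinates(1)[of K K "1 / 4" "\<lambda>t. g (x, t)"])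
      (use finite_K T_lazy yz[of x] bdd in auto)
  have z: "T (T (\<lambda>z. g (x, y, z))) = (\<lambda>z. g (x, y, z))" for x y
    by (rule two_step_invariant_coordinates(2)[of K K "1 / 4" "\<lambda>t. g (x, t)"])
      (use finite_K T_lazy yz[of x] bdd in auto)
  have eq: "g (x, y, z) = g (u, u, u)"
    if "(x, y, z) \<in> same_parity" "u \<in> V" "parity u = parity x" for x y z u
  proof -
    have "g (x, y, z) = g (u, y, z)"
      by (rule two_step_harmonic_parity[OF x]) (use that bdd in \<open>auto simp: same_parity_def\<close>)
    also have "\<dots> = g (u, u, z)"
      by (rule two_step_harmonic_parity[OF y]) (use that bdd in \<open>auto simp: same_parity_def\<close>)
    also have "\<dots> = g (u, u, u)"
      by (rule two_step_harmonic_parity[OF z]) (use that bdd in \<open>auto simp: same_parity_def\<close>)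
    finally show ?thesis .
  qed
  obtain a b c where s_eq: "s = (a, b, c)" by (cases s)
  show ?thesis
  proof (cases "parity v = parity a")
    case True then show ?thesis using eq[of a b c v] s v by (simp add: s_eq)
  next
    case False
    obtain u where u: "u \<in> nb v" using nb_nonempty[OF v] by blast
    have uV: "u \<in> V" and up: "parity u \<longleftrightarrow> \<not> parity v" using nb_subset[OF v u] parity_nb[OF v u] by auto
    have "g (v, v, v) = avg K3 g (v, v, v)" by (simp add: harm)
    also have "\<dots> = avg K3 (\<lambda>_. g (u, u, u)) (v, v, v)"
    proof (rule avg_cong)
      fix t assume t: "t \<in> set_pmf (K3 (v, v, v))"
      obtain x y z where t_eq: "t = (x, y, z)" by (cases t)
      have "(v, v, v) \<in> same_parity" using v by (simp add: same_parity_def)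
      hence "t \<in> same_parity" using t by (rule same_parity_step)
      moreover have "parity x \<longleftrightarrow> \<not> parity v"
        using t v by (intro parity_nb) (auto simp: t_eq K3_def pair_kernel_def set_K)
      ultimately show "g t = g (u, u, u)" using eq[of x y z u] uV up by (simp add: t_eq)
    qed
    also have "\<dots> = g (u, u, u)"
      by (simp add: markov_op_const[OF markov_op_avg[OF finite_K3]])
    also have "\<dots> = g s" using eq[of a b c u] s uV up False by (simp add: s_eq)
    finally show ?thesis by simp
  qed
qed

end

section \<open>Typical environments\<close>

text \<open>
  The logarithmic averages of the window volumes have bounded mean, as the window at time \<open>k\<close>
  consists of \<open>O(\<surd>k)\<close> columns of finite mean height. By Fatou's lemma their lower limit is finite almost
  surely, for all of the countably many centres simultaneously.
\<close>

lemma typical_environment: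
  fixes f :: "int \<Rightarrow> 'a \<Rightarrow> real"
  assumes "prob_space M" and meas: "\<And>x. f x \<in> borel_measurable M"
    and distr: "\<And>x. distr M borel (f x) = \<mu>"
    and nonneg: "AE x in \<mu>. 0 \<le> x" and int: "integrable \<mu> (\<lambda>x. x)"
  shows "AE \<xi> in M. (\<forall>x. 0 \<le> f x \<xi>) \<and> moderate_growth (\<lambda>x. f x \<xi>)"
proof -
  interpret prob_space M by fact
  note [measurable] = meas
  have nn: "AE \<xi> in M. \<forall>x. 0 \<le> f x \<xi>"
    unfolding AE_all_countable
  proof
    fix x
    have "AE y in distr M borel (f x). 0 \<le> y" unfolding distr by (rule nonneg)
    then show "AE \<xi> in M. 0 \<le> f x \<xi>" by (subst (asm) AE_distr_iff) auto
  qed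
  define m where "m = (\<integral>x. x \<partial>\<mu>)"
  have fint: "integrable M (f x)" for x
  proof -
    have "integrable (distr M borel (f x)) (\<lambda>y. y)" unfolding distr by (rule int)
    then show ?thesis by (subst (asm) integrable_distr_eq) auto
  qed
  have fm: "expectation (f x) = m" for x
    unfolding m_def distr[of x, symmetric] by (subst integral_distr) auto
  have "m \<ge> 0" unfolding m_def using nonneg by (rule integral_nonneg_AE)
  have "AE \<xi> in M. \<exists>t>0. \<exists>\<^sub>F n in sequentially.
    (\<Sum>k=1..n. window_volume (\<lambda>x. f x \<xi>) a k / (real k * sqrt k))
      \<le> t * harm n" for a :: int
  proof -
    define I where "I k = {a - \<lfloor>3 * sqrt (real k)\<rfloor>..a + \<lfloor>3 * sqrt (real k)\<rfloor>}" for k :: nat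
    define S where "S n \<xi> = (\<Sum>k=1..n. (\<Sum>x\<in>I k. 2 * f x \<xi> + 1) / (real k * sqrt k))" for n \<xi>
    define C where "C = 7 * (2 * m + 1)"
    have Sint: "integrable M (S n)" for n
      unfolding S_def
      by (intro Bochner_Integration.integrable_sum integrable_divide Bochner_Integration.integrable_add
          integrable_mult_right fint) auto
    have cardI: "real (card (I k)) \<le> 7 * sqrt k" if "k \<ge> 1" for k
    proof -
      have "1 \<le> sqrt k" using that by simp
      moreover have "real_of_int \<lfloor>3 * sqrt k\<rfloor> \<le> 3 * sqrt k" by simp
      moreover have "real (card (I k)) = 2 * real_of_int \<lfloor>3 * sqrt k\<rfloor> + 1"
        by (simp add: I_def)
      ultimately show ?thesis by linarith
    qed
    have ES: "expectation (S n) \<le> C * harm n" for n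
    proof -
      have "expectation (S n) = (\<Sum>k=1..n. (\<Sum>x\<in>I k. 2 * m + 1) / (real k * sqrt k))"
        unfolding S_def using fint
        by (simp add: Bochner_Integration.integral_sum fm prob_space Bochner_Integration.integrable_sum)
      also have "\<dots> \<le> (\<Sum>k=1..n. C * inverse (real k))"
      proof (rule sum_mono)
        fix k assume "k \<in> {1..n}"
        hence k: "k \<ge> 1" by simp
        have "(\<Sum>x\<in>I k. 2 * m + 1) \<le> 7 * sqrt k * (2 * m + 1)"
          using cardI[OF k] \<open>m \<ge> 0\<close> by (simp add: mult_right_mono)
        hence "(\<Sum>x\<in>I k. 2 * m + 1) / (real k * sqrt k) \<le> 7 * sqrt k * (2 * m + 1) / (real k * sqrt k)"
          by (intro divide_right_mono) auto
        also have "\<dots> = C * inverse (real k)" using k by (simp add: C_def field_simps)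
        finally show "(\<Sum>x\<in>I k. 2 * m + 1) / (real k * sqrt k) \<le> C * inverse (real k)" .
      qed
      finally show ?thesis by (simp add: harm_def sum_distrib_left)
    qed
    \<comment> \<open>the shift by one avoids the empty sum, whose harmonic number vanishes\<close>
    define R where "R n \<xi> = S (Suc n) \<xi> / harm (Suc n)" for n \<xi>
    have hpos: "(0::real) < harm (Suc n)" for n by (rule harm_pos) simp
    have Rm: "(\<lambda>\<xi>. ennreal (R n \<xi>)) \<in> borel_measurable M" for n
      unfolding R_def S_def by measurable
    have nnR: "(\<integral>\<^sup>+ \<xi>. ennreal (R n \<xi>) \<partial>M) \<le> ennreal C" for n
    proof -
      have "AE \<xi> in M. 0 \<le> R n \<xi>"
        using nn
      proof eventually_elim
        case (elim \<xi>)
        have "0 \<le> S (Suc n) \<xi>"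
          unfolding S_def by (intro sum_nonneg divide_nonneg_nonneg) (use elim in auto)
        then show ?case unfolding R_def by (intro divide_nonneg_nonneg less_imp_le[OF hpos])
      qed
      moreover have "integrable M (R n)" unfolding R_def by (intro integrable_divide Sint)
      ultimately have "(\<integral>\<^sup>+ \<xi>. ennreal (R n \<xi>) \<partial>M) = ennreal (expectation (R n))"
        by (intro nn_integral_eq_integral)
      also have "expectation (R n) = expectation (S (Suc n)) / harm (Suc n)" by (simp add: R_def[abs_def])
      also have "\<dots> \<le> C" using ES[of "Suc n"] hpos[of n] by (simp add: divide_le_eq)
      finally show ?thesis by (simp add: ennreal_leI)
    qed
    have "(\<integral>\<^sup>+ \<xi>. liminf (\<lambda>n. ennreal (R n \<xi>)) \<partial>M) \<le> liminf (\<lambda>n. \<integral>\<^sup>+ \<xi>. ennreal (R n \<xi>) \<partial>M)"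
      by (rule nn_integral_liminf[OF Rm])
    also have "\<dots> \<le> liminf (\<lambda>n. ennreal C)" by (intro Liminf_mono always_eventually allI nnR)
    also have "\<dots> = ennreal C" by (simp add: Liminf_const)
    also have "\<dots> < \<infinity>" by simp
    finally have "(\<integral>\<^sup>+ \<xi>. liminf (\<lambda>n. ennreal (R n \<xi>)) \<partial>M) \<noteq> \<infinity>" by simp
    hence "AE \<xi> in M. liminf (\<lambda>n. ennreal (R n \<xi>)) \<noteq> \<infinity>"
      by (intro nn_integral_noteq_infinite borel_measurable_liminf Rm)
    then show ?thesis
    proof eventually_elim
      fix \<xi> assume fin: "liminf (\<lambda>n. ennreal (R n \<xi>)) \<noteq> \<infinity>"
      define l where "l = enn2real (liminf (\<lambda>n. ennreal (R n \<xi>)))"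
      have l: "liminf (\<lambda>n. ennreal (R n \<xi>)) = ennreal l" "0 \<le> l"
        using fin by (simp_all add: l_def less_top)
      have "\<exists>\<^sub>F n in sequentially. R n \<xi> \<le> l + 1"
      proof (rule ccontr)
        assume "\<not> ?thesis"
        hence "\<forall>\<^sub>F n in sequentially. l + 1 < R n \<xi>" by (simp add: not_frequently not_le)
        hence "\<forall>\<^sub>F n in sequentially. ennreal (l + 1) \<le> ennreal (R n \<xi>)"
          by eventually_elim (simp add: ennreal_leI)
        hence "ennreal (l + 1) \<le> liminf (\<lambda>n. ennreal (R n \<xi>))" by (rule Liminf_bounded)
        then show False using l by simp
      qed
      hence "\<exists>\<^sub>F n in sequentially. S (Suc n) \<xi> \<le> (l + 1) * harm (Suc n)"
        by (rule frequently_elim1) (use hpos in \<open>simp add: R_def divide_le_eq\<close>)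
      hence "\<exists>\<^sub>F n in sequentially. S n \<xi> \<le> (l + 1) * harm n"
        unfolding frequently_sequentially by (meson Suc_leD Suc_le_mono le_Suc_eq)
      then show "\<exists>t>0. \<exists>\<^sub>F n in sequentially.
          (\<Sum>k=1..n. window_volume (\<lambda>x. f x \<xi>) a k / (real k * sqrt k))
            \<le> t * harm n"
        using \<open>0 \<le> l\<close> unfolding S_def I_def window_volume_def by (intro exI[of _ "l + 1"]) simp
    qed
  qed
  hence "AE \<xi> in M. moderate_growth (\<lambda>x. f x \<xi>)"
    unfolding moderate_growth_def by (simp add: AE_all_countable)
  with nn show ?thesis by eventually_elim blast
qed

section \<open>Three independent walks\<close>

context comb
begin

text \<open>
  A history of positive probability stays on the comb, where \<open>K\<close> is the uniform law on the
  neighbours. For a null history both sides vanish.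
\<close>

lemma walk_cylinder_step:
  assumes walk: "simple_random_walk (comb_edges F) v N X" and v: "v \<in> V"
  shows "measure N {\<omega> \<in> space N. \<forall>k\<le>Suc n. X k \<omega> = h k}
    = measure N {\<omega> \<in> space N. \<forall>k\<le>n. X k \<omega> = h k} * pmf (K (h n)) (h (Suc n))"
proof -
  interpret prob_space N using walk by (simp add: simple_random_walk_def)
  have X: "X n \<in> measurable N (count_space UNIV)" for n
    using walk by (simp add: simple_random_walk_def)
  define c where "c n = {\<omega> \<in> space N. \<forall>k\<le>n. X k \<omega> = h k}" for n
  have c_event: "c n \<in> events" for n
  proof -
    have "c n = (\<Inter>k\<in>{..n}. X k -` {h k} \<inter> space N)" by (auto simp: c_def)
    also have "\<dots> \<in> events" by (intro sets.finite_INT measurable_sets[OF X]) auto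
    finally show ?thesis .
  qed
  have le: "prob (c (Suc n)) \<le> prob (c n)" for n
    by (intro finite_measure_mono c_event) (auto simp: c_def)
  have step: "prob (c (Suc n)) = prob (c n) * pmf (pmf_of_set (nb (h n))) (h (Suc n))"
    if "prob (c n) > 0" for n
  proof -
    have "\<P>(\<omega> in N. X (Suc n) \<omega> = h (Suc n) \<bar> \<forall>k\<le>n. X k \<omega> = h k)
          = pmf (pmf_of_set (nb (h n))) (h (Suc n))"
      using walk that unfolding simple_random_walk_def c_def nb_def by blast
    moreover have "{\<omega> \<in> space N. X (Suc n) \<omega> = h (Suc n) \<and> (\<forall>k\<le>n. X k \<omega> = h k)} = c (Suc n)"
      by (auto simp: c_def le_Suc_eq)
    ultimately show ?thesis using that by (simp add: cond_prob_def c_def[symmetric] field_simps)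
  qed
  have inV: "h n \<in> V" if "prob (c n) > 0" for n
    using that
  proof (induction n)
    case 0
    have "h 0 = v"
    proof (rule ccontr)
      assume "h 0 \<noteq> v"
      have "AE \<omega> in N. X 0 \<omega> = v" using walk by (simp add: simple_random_walk_def)
      hence "AE \<omega> in N. \<omega> \<notin> c 0" by eventually_elim (use \<open>h 0 \<noteq> v\<close> in \<open>auto simp: c_def\<close>)
      hence "prob (c 0) = 0" using c_event by (subst prob_eq_0) auto
      then show False using 0 by simp
    qed
    then show ?case using v by simp
  next
    case (Suc n)
    have pos: "prob (c n) > 0" using le[of n] Suc.prems by linarith
    have hV: "h n \<in> V" by (rule Suc.IH[OF pos])
    have "pmf (pmf_of_set (nb (h n))) (h (Suc n)) > 0"
      using step[OF pos] Suc.prems by (simp add: zero_less_mult_iff)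
    hence "h (Suc n) \<in> nb (h n)"
      by (simp add: finite_nb[OF hV] nb_nonempty[OF hV] indicator_def of_bool_def split: if_splits)
    then show ?case by (rule nb_subset[OF hV])
  qed
  have "prob (c (Suc n)) = prob (c n) * pmf (K (h n)) (h (Suc n))"
  proof (cases "prob (c n) > 0")
    case True then show ?thesis using step[OF True] inV[OF True] by (simp add: K_def)
  next
    case False
    hence "prob (c n) = 0" using measure_nonneg[of N "c n"] by linarith
    then show ?thesis using le[of n] measure_nonneg[of N "c (Suc n)"] by simp
  qed
  then show ?thesis by (simp add: c_def)
qed

text \<open>
  Independence of the trajectories factorises the probabilities of joint histories, and each factor
  satisfies its own recursion.
\<close>

lemma three_walks_markov_chain:
  assumes walk: "\<And>i. i < 3 \<Longrightarrow> simple_random_walk (comb_edges F) v N (X i)" and v: "v \<in> V"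
    and indep: "indep_walks N X {..<3}"
  shows "markov_chain N (\<lambda>n \<omega>. (X 0 n \<omega>, X 1 n \<omega>, X 2 n \<omega>)) K3"
proof -
  interpret prob_space N using walk[of 0] by (simp add: simple_random_walk_def)
  have X: "X i n \<in> measurable N (count_space UNIV)" if "i < 3" for i n
    using walk[OF that] by (simp add: simple_random_walk_def)
  define c where "c i n h = {\<omega> \<in> space N. \<forall>k\<le>n. X i k \<omega> = h k}" for i n and h :: "nat \<Rightarrow> int \<times> int"
  have three: "{..<3::nat} = {0, 1, 2}" by auto
  have joint: "prob {\<omega> \<in> space N. \<forall>k\<le>n. (X 0 k \<omega>, X 1 k \<omega>, X 2 k \<omega>) = h k}
      = prob (c 0 n (\<lambda>k. fst (h k))) * prob (c 1 n (\<lambda>k. fst (snd (h k)))) * prob (c 2 n (\<lambda>k. snd (snd (h k))))"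
    for n and h :: "nat \<Rightarrow> (int \<times> int) \<times> (int \<times> int) \<times> (int \<times> int)"
  proof -
    define g where "g i k = (if i = 0 then fst (h k) else if i = 1 then fst (snd (h k)) else snd (snd (h k)))"
      for i :: nat and k
    define A where "A i = {w :: nat \<Rightarrow> int \<times> int. \<forall>k\<le>n. w k = g i k}" for i
    have A: "A i \<in> sets (PiM UNIV (\<lambda>_::nat. count_space UNIV))" for i
    proof -
      have "A i = (\<Inter>k\<in>{..n}. (\<lambda>w. w k) -` {g i k} \<inter> space (PiM UNIV (\<lambda>_::nat. count_space UNIV)))"
        by (auto simp: A_def space_PiM)
      also have "\<dots> \<in> sets (PiM UNIV (\<lambda>_::nat. count_space UNIV))"
        by (intro sets.finite_INT measurable_sets[OF measurable_component_singleton]) auto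
      finally show ?thesis .
    qed
    have "prob (\<Inter>i\<in>{..<3}. (\<lambda>\<omega> n. X i n \<omega>) -` A i \<inter> space N)
        = (\<Prod>i\<in>{..<3}. prob ((\<lambda>\<omega> n. X i n \<omega>) -` A i \<inter> space N))"
      by (rule indep_varsD[OF indep[unfolded indep_walks_def]]) (use A three in auto)
    moreover have "(\<lambda>\<omega> n. X i n \<omega>) -` A i \<inter> space N = c i n (g i)" for i
      by (auto simp: A_def c_def)
    moreover have "{\<omega> \<in> space N. \<forall>k\<le>n. (X 0 k \<omega>, X 1 k \<omega>, X 2 k \<omega>) = h k} = (\<Inter>i\<in>{..<3}. c i n (g i))"
      unfolding three by (auto simp: c_def g_def prod_eq_iff)
    ultimately show ?thesis by (simp add: three g_def[abs_def] mult.assoc)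
  qed
  show ?thesis
  proof unfold_locales
    fix n
    have "(\<lambda>\<omega>. (X 0 n \<omega>, X 1 n \<omega>, X 2 n \<omega>)) -` {s} \<inter> space N \<in> events" for s
    proof -
      have "(\<lambda>\<omega>. (X 0 n \<omega>, X 1 n \<omega>, X 2 n \<omega>)) -` {s} \<inter> space N =
        (X 0 n -` {fst s} \<inter> space N) \<inter> (X 1 n -` {fst (snd s)} \<inter> space N) \<inter> (X 2 n -` {snd (snd s)} \<inter> space N)"
        by (auto simp: prod_eq_iff)
      then show ?thesis using measurable_sets[OF X] by (auto intro!: sets.Int)
    qed
    then show "(\<lambda>\<omega>. (X 0 n \<omega>, X 1 n \<omega>, X 2 n \<omega>)) \<in> measurable N (count_space UNIV)"
      by (subst measurable_count_space_eq_countable) auto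
  next
    show "finite (set_pmf (K3 s))" for s by (rule finite_K3)
  next
    fix n and h :: "nat \<Rightarrow> (int \<times> int) \<times> (int \<times> int) \<times> (int \<times> int)"
    have st: "prob (c i (Suc n) g) = prob (c i n g) * pmf (K (g n)) (g (Suc n))" if "i < 3" for i g
      unfolding c_def by (rule walk_cylinder_step[OF walk[OF that] v])
    have "pmf (K3 (h n)) (h (Suc n)) = pmf (K (fst (h n))) (fst (h (Suc n)))
       * pmf (K (fst (snd (h n)))) (fst (snd (h (Suc n)))) * pmf (K (snd (snd (h n)))) (snd (snd (h (Suc n))))"
      by (cases "h n"; cases "h (Suc n)") (auto simp: K3_def pair_kernel_def pmf_pair)
    then show "prob {\<omega> \<in> space N. \<forall>k\<le>Suc n. (X 0 k \<omega>, X 1 k \<omega>, X 2 k \<omega>) = h k}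
      = prob {\<omega> \<in> space N. \<forall>k\<le>n. (X 0 k \<omega>, X 1 k \<omega>, X 2 k \<omega>) = h k} * pmf (K3 (h n)) (h (Suc n))"
      unfolding joint by (simp add: st mult_ac)
  qed
qed

lemma infinite_triple_collisions:
  assumes walk: "\<And>i. i < 3 \<Longrightarrow> simple_random_walk (comb_edges F) v N (X i)" and v: "v \<in> V"
    and indep: "indep_walks N X {..<3}"
    and growth: "moderate_growth F"
  shows "AE \<omega> in N. infinite {n. X 0 n \<omega> = X 1 n \<omega> \<and> X 1 n \<omega> = X 2 n \<omega>}"
proof -
  obtain t where "t > 0" and vol: "\<exists>\<^sub>F n in sequentially.
      (\<Sum>k=1..n. window_volume F (fst v) k / (real k * sqrt k)) \<le> t * harm n"
    using growth unfolding moderate_growth_def by blast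
  define Y where "Y = (\<lambda>n \<omega>. (X 0 n \<omega>, X 1 n \<omega>, X 2 n \<omega>))"
  interpret markov_chain N Y K3
    unfolding Y_def by (rule three_walks_markov_chain[OF walk v indep])
  have "AE \<omega> in N. X i 0 \<omega> = v" if "i < 3" for i
    using walk[OF that] by (simp add: simple_random_walk_def)
  from this[of 0] this[of 1] this[of 2]
  have start: "AE \<omega> in N. Y 0 \<omega> = (v, v, v)" by (auto simp: Y_def)
  have "prob (inf_visits diag) > 0"
  proof (rule inf_visits_pos[OF start])
    show "\<exists>\<^sub>F n in sequentially. 1 / (4 * t\<^sup>2) * harm n \<le> (\<Sum>k=1..n. (avg K3 ^^ k) (indicator diag) (v, v, v))"
      using vol by (rule frequently_elim1) (rule collision_sum_lower[OF v \<open>t > 0\<close>])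
    show "(avg K3 ^^ m) (indicator diag) s \<le> 4096 / real m" if "s \<in> diag" "m \<ge> 1" for m s
      by (rule collision_prob_upper[OF that])
  qed (use \<open>t > 0\<close> in auto)
  moreover have "prob (inf_visits diag) = 0 \<or> prob (inf_visits diag) = 1"
  proof (rule zero_one_law[OF start])
    fix n h assume pos: "prob (hist n h) > 0" and h0: "h 0 = (v, v, v)"
    have "prob (hist n h) > 0 \<Longrightarrow> h n \<in> same_parity" for n
    proof (induction n)
      case 0 then show ?case using v by (simp add: h0 same_parity_def)
    next
      case (Suc n)
      have p: "prob (hist n h) > 0" "pmf (K3 (h n)) (h (Suc n)) > 0"
        using Suc.prems measure_nonneg[of N "hist n h"] pmf_nonneg[of "K3 (h n)" "h (Suc n)"]
        by (auto simp: prob_hist_Suc zero_less_mult_iff)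
      then show ?case using same_parity_step[OF Suc.IH[OF p(1)]] by (simp add: pmf_positive_iff)
    qed
    from this[OF pos]
    show "inf_prob K3 diag (h n) = inf_prob K3 diag (v, v, v)"
      by (intro harmonic_const_same_parity inf_prob_harmonic inf_prob_bounds finite_K3 v)
  qed
  ultimately have "prob (inf_visits diag) = 1" by linarith
  hence "AE \<omega> in N. \<omega> \<in> inf_visits diag" by (subst (asm) prob_eq_1) auto
  then show ?thesis
  proof eventually_elim
    fix \<omega> assume "\<omega> \<in> inf_visits diag"
    hence "infinite {n. Y n \<omega> \<in> diag}" by (simp add: inf_visits_eq)
    moreover have "{n. Y n \<omega> \<in> diag} \<subseteq> {n. X 0 n \<omega> = X 1 n \<omega> \<and> X 1 n \<omega> = X 2 n \<omega>}"
      by (auto simp: diag_def Y_def)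
    ultimately show "infinite {n. X 0 n \<omega> = X 1 n \<omega> \<and> X 1 n \<omega> = X 2 n \<omega>}"
      using infinite_super by blast
  qed
qed

end

theorem theorem1p2:
  fixes M :: "'a measure" and f :: "int \<Rightarrow> 'a \<Rightarrow> real" and \<mu> :: "real measure"
  assumes "prob_space M"
    and "prob_space.indep_vars M (\<lambda>_. borel) f UNIV"
    and "\<And>n. distr M borel (f n) = \<mu>"
    and "AE x in \<mu>. 0 \<le> x"
    and "integrable \<mu> (\<lambda>x. x)"
  shows "AE \<xi> in M. \<forall>v \<in> comb_vertices (\<lambda>n. f n \<xi>).
           \<forall>(N :: 'b measure) (X :: nat \<Rightarrow> nat \<Rightarrow> 'b \<Rightarrow> int \<times> int).
             (\<forall>i<3. simple_random_walk (comb_edges (\<lambda>n. f n \<xi>)) v N (X i)) \<longrightarrow>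
             indep_walks N X {..<3} \<longrightarrow>
             (AE \<omega> in N. infinite {n. X 0 n \<omega> = X 1 n \<omega> \<and> X 1 n \<omega> = X 2 n \<omega>})"
proof -
  have meas: "f x \<in> borel_measurable M" for x
    using assms(2) by (simp add: prob_space.indep_vars_def2[OF assms(1)])
  have "AE \<xi> in M. (\<forall>x. 0 \<le> f x \<xi>) \<and> moderate_growth (\<lambda>x. f x \<xi>)"
    by (rule typical_environment[OF assms(1) meas assms(3-5)])
  then show ?thesis
  proof eventually_elim
    case (elim \<xi>)
    then interpret comb "\<lambda>x. f x \<xi>" by unfold_locales blast
    show ?case
    proof (intro ballI allI impI)
      fix v and N :: "'b measure" and X :: "nat \<Rightarrow> nat \<Rightarrow> 'b \<Rightarrow> int \<times> int"
      assume v: "v \<in> V" and walk: "\<forall>i<3. simple_random_walk (comb_edges (\<lambda>n. f n \<xi>)) v N (X i)"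
        and indep: "indep_walks N X {..<3}"
      show "AE \<omega> in N. infinite {n. X 0 n \<omega> = X 1 n \<omega> \<and> X 1 n \<omega> = X 2 n \<omega>}"
        by (rule infinite_triple_collisions[OF walk[rule_format] v indep conjunct2[OF elim]])
    qed
  qed
qed

end
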